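(* Let $m,n,p$ be natural numbers (positive integers) and let $\mathfrak t:=\{(m,n,p),(n,p,m),(p,m,n)\}$ (the three cyclic rotations; sums over $\mathfrak t$ have three terms, one for each rotation). Then $$\sum_{(a,b,c)\in\mathfrak t}\left(\mathrm{cr}_{(2)}(K_{a,b})+ab\left\lfloor\frac{c-1}{2}\right\rfloor\left\lfloor\frac{c}{2}\right\rfloor\right)\;\le\;\mathrm{cr}_{(3)}(K_{m,n,p})\;\le\;\sum_{(a,b,c)\in\mathfrak t}\left(\binom a2\binom b2+ab\left\lfloor\frac{c-1}{2}\right\rfloor\left\lfloor\frac{c}{2}\right\rfloor\right).$$
   Context: $K_{a,b}$ and $K_{m,n,p}$ denote the complete bipartite and complete tripartite graphs with parts of the indicated sizes. A $k$-partite-circle drawing of a complete $k$-partite graph is a drawing in the plane in which the vertices are placed on $k$ pairwise disjoint circles, each part of the vertex partition on its own circle, and no edge crosses any of the circles. $\mathrm{cr}_{(k)}(G)$, the $k$-partite-circle crossing number, is the minimum number of edge crossings over all $k$-partite-circle drawings of $G$. Thus $\mathrm{cr}_{(2)}(K_{a,b})$ is the bipartite-circle (bipartite cylindrical) crossing number and $\mathrm{cr}_{(3)}(K_{m,n,p})$ is the tripartite-circle crossing number. *)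

theory Defs
  imports "HOL-Analysis.Analysis" "HOL-Library.Extended_Nat"
begin

text \<open>
  The complete multipartite graph with part sizes \<open>ns\<close>: the vertex \<open>(i, j)\<close> is the
  \<open>j\<close>-th vertex of the \<open>i\<close>-th part.  So \<open>[a, b]\<close> stands for $K_{a,b}$ and
  \<open>[m, n, p]\<close> for $K_{m,n,p}$.
\<close>

definition multipartite_verts :: "nat list \<Rightarrow> (nat \<times> nat) set" where
  "multipartite_verts ns = (SIGMA i:{..<length ns}. {..<ns ! i})"

definition multipartite_edges :: "nat list \<Rightarrow> (nat \<times> nat) set set" where
  "multipartite_edges ns =
     {{u, v} | u v. u \<in> multipartite_verts ns \<and> v \<in> multipartite_verts ns \<and> fst u \<noteq> fst v}"

definition path_interior :: "(real \<Rightarrow> complex) \<Rightarrow> complex set" where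
  "path_interior g = path_image g - {pathstart g, pathfinish g}"

text \<open>
  A drawing in the plane: vertices are distinct points, every edge is a simple arc joining
  its two end vertices and passing through no other vertex, and two edges meet in finitely
  many points.  Edges may cross repeatedly, and adjacent edges may cross.
\<close>

definition drawing ::
    "'v set \<Rightarrow> 'v set set \<Rightarrow> ('v \<Rightarrow> complex) \<Rightarrow> ('v set \<Rightarrow> real \<Rightarrow> complex) \<Rightarrow> bool" where
  "drawing V E pos \<gamma> \<longleftrightarrow>
     inj_on pos V \<and>
     (\<forall>e\<in>E. arc (\<gamma> e) \<and> {pathstart (\<gamma> e), pathfinish (\<gamma> e)} = pos ` e \<and>
            path_interior (\<gamma> e) \<inter> pos ` V = {}) \<and>
     (\<forall>e\<in>E. \<forall>f\<in>E. e \<noteq> f \<longrightarrow> finite (path_image (\<gamma> e) \<inter> path_image (\<gamma> f)))"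

text \<open>
  A crossing is an unordered pair of distinct edges together with a common interior point;
  a point interior to \<open>r\<close> edges thus counts \<open>r choose 2\<close> times.
\<close>

definition crossings :: "'v set set \<Rightarrow> ('v set \<Rightarrow> real \<Rightarrow> complex) \<Rightarrow> nat" where
  "crossings E \<gamma> =
     card {({e, f}, x) | e f x. e \<in> E \<and> f \<in> E \<and> e \<noteq> f \<and>
                                x \<in> path_interior (\<gamma> e) \<inter> path_interior (\<gamma> f)}"

text \<open>
  Part \<open>i\<close> lies on the circle \<open>sphere (ctr i) (rad i)\<close>.  Circles may be nested; only the
  curves have to be disjoint.
\<close>

definition partite_circle_drawing ::
    "nat list \<Rightarrow> (nat \<times> nat \<Rightarrow> complex) \<Rightarrow> ((nat \<times> nat) set \<Rightarrow> real \<Rightarrow> complex) \<Rightarrow> bool" where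
  "partite_circle_drawing ns pos \<gamma> \<longleftrightarrow>
     drawing (multipartite_verts ns) (multipartite_edges ns) pos \<gamma> \<and>
     (\<exists>(ctr :: nat \<Rightarrow> complex) (rad :: nat \<Rightarrow> real).
        (\<forall>i<length ns. rad i > 0) \<and>
        (\<forall>i<length ns. \<forall>j<length ns. i \<noteq> j \<longrightarrow>
           sphere (ctr i) (rad i) \<inter> sphere (ctr j) (rad j) = {}) \<and>
        (\<forall>i<length ns. \<forall>j<ns ! i. pos (i, j) \<in> sphere (ctr i) (rad i)) \<and>
        (\<forall>e\<in>multipartite_edges ns. \<forall>i<length ns.
           path_interior (\<gamma> e) \<inter> sphere (ctr i) (rad i) = {}))"

text \<open>
  The \<open>k\<close>-partite-circle crossing number, with \<open>k = length ns\<close>.  The infimum in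
  \<^typ>\<open>enat\<close> is a minimum as soon as a drawing exists, and is infinite otherwise.
\<close>

definition partite_circle_cr :: "nat list \<Rightarrow> enat" where
  "partite_circle_cr ns =
     Inf {enat (crossings (multipartite_edges ns) \<gamma>) | pos \<gamma>. partite_circle_drawing ns pos \<gamma>}"

end

theory Submission imports Defs "HOL-Complex_Analysis.Riemann_Mapping" begin

text \<open>
  Lower bound.  Split the crossings by the parts that the two edges join.  Edges between the same
  two parts form a bipartite-circle drawing.  For the rest, fix a circle \<open>C\<close> with \<open>c\<close> vertices and one
  vertex \<open>u\<close>, \<open>v\<close> on each of the two other circles.  The edge \<open>uv\<close> does not meet \<open>C\<close>, so after
  an inversion if necessary both stars from \<open>u\<close> and \<open>v\<close> to \<open>C\<close> lie in the disc bounded by \<open>C\<close>.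
  Among any three vertices of \<open>C\<close>, an edge of one star crosses an edge of the other that leads to a
  different vertex; this is the nonplanarity of $K_{3,3}$ with the third vertex inserted on the other side
  of \<open>C\<close>, and it is proved with winding numbers, so that edges of the same star may cross each other.
  By Mantel's theorem, applied to the pairs of vertices without such a crossing, at least
  \<open>\<lfloor>(c-1)/2\<rfloor>\<lfloor>c/2\<rfloor>\<close> pairs have one.

  Upper bound.  Put the circles at the corners of an equilateral triangle and cut the plane along the
  perpendicular bisectors.  Of the vertices on a circle, place one half in the angle towards the triangle
  and the other half opposite.  In each cell the edges are spirals, i.e. straight segments
  in the coordinates (relative distance from circle to cell boundary, angle); they leave the cell
  through a short interval facing the circle at the other end.
\<close>

subsection \<open>Two stars in a disc\<close>

text \<open>Drawings may let adjacent edges cross and let edges cross repeatedly, so the stars at a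
  circle need not be embedded trees and nonplanarity of a graph cannot simply be quoted. What is
  needed is an invariant that reacts only to intersections of edges leading to different vertices;
  differences of winding numbers of open paths are such an invariant. The number
  \<open>((c - 1) div 2) * (c div 2)\<close> occurs in both bounds because it counts the pairs
  inside two nearly equal halves of \<open>c\<close> vertices. In the lower bound the pairs without
  a crossing are triangle-free, and the extremal case is the complete bipartite graph between two
  halves; the construction realises it, since vertices in different halves produce no crossing of
  this kind. What separates the two bounds is only the crossings among edges joining the same two
  parts. Linearity of the spirals turns each crossing into one linear equation, so two edges cross
  at most once and signs decide whether they can.\<close>

lemma mult_cnj_norm_1: "norm (z::complex) = 1 \<Longrightarrow> z * cnj z = 1"
  using complex_norm_square[of z] by simp

text \<open>The disc touches the line \<open>Re (cnj x * z) = 1\<close> only at \<open>x\<close>. As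
  \<open>1 - cnj x * z = cnj x * (x - z)\<close>, the principal logarithm of the left side is a
  continuous branch of the logarithm of \<open>x - z\<close> up to a constant.\<close>

lemma Re_one_minus_cnj_mult_pos:
  fixes x z :: complex
  assumes "norm x = 1" "norm z \<le> 1" "z \<noteq> x"
  shows "Re (1 - cnj x * z) > 0"
proof -
  have "norm (cnj x * z) \<le> 1"
    using assms by (simp add: norm_mult)
  then have le: "Re (cnj x * z) \<le> 1"
    using complex_Re_le_cmod order_trans by blast
  have "Re (cnj x * z) \<noteq> 1"
  proof
    assume 1: "Re (cnj x * z) = 1"
    then have "1 + (Im (cnj x * z))\<^sup>2 \<le> 1"
      using \<open>norm (cnj x * z) \<le> 1\<close> by (simp add: cmod_def)
    then have "cnj x * z = 1" using 1 by (simp add: complex_eq_iff)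
    then have "(x * cnj x) * z = x" by (simp add: mult.assoc)
    moreover have "x * cnj x = 1" using assms(1) by (simp add: mult_cnj_norm_1)
    ultimately show False using assms(3) by simp
  qed
  with le show ?thesis by simp
qed

text \<open>Two logarithms of one number differ by a multiple of \<open>2 * pi * \<i>\<close>, so
  distinct values of \<open>f\<close> are at least \<open>2 * pi\<close> apart.\<close>

lemma continuous_on_exp_constant_eq:
  fixes f :: "'a::topological_space \<Rightarrow> complex"
  assumes "connected S" "continuous_on S f" "\<And>z. z \<in> S \<Longrightarrow> exp (f z) = c" "x \<in> S" "y \<in> S"
  shows "f x = f y"
proof -
  have "\<exists>e>0. \<forall>y. y \<in> S \<and> f y \<noteq> f x \<longrightarrow> e \<le> norm (f y - f x)" if "x \<in> S" for x
  proof (intro exI conjI allI impI)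
    show "(0::real) < 2 * pi" by simp
    fix y assume y: "y \<in> S \<and> f y \<noteq> f x"
    then have "exp (f y) = exp (f x)" using assms(3) that by simp
    then obtain n :: int where n: "f y = f x + (of_int (2 * n) * pi) * \<i>"
      by (auto simp: exp_eq)
    with y have "n \<noteq> 0" by auto
    then have "1 \<le> \<bar>real_of_int n\<bar>" by linarith
    then show "2 * pi \<le> norm (f y - f x)"
      using n by (simp add: norm_mult)
  qed
  then have "f constant_on S"
    using continuous_discrete_range_constant[OF assms(1,2)] by blast
  then show ?thesis using assms(4,5) unfolding constant_on_def by metis
qed

lemma continuous_on_Ln_one_minus_cnj_mult:
  assumes "norm x = 1" "S \<subseteq> cball 0 1" "x \<notin> S"
  shows "continuous_on S (\<lambda>z. Ln (1 - cnj x * z))"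
proof -
  have "1 - cnj x * z \<notin> \<real>\<^sub>\<le>\<^sub>0" if "z \<in> S" for z
  proof -
    have "norm z \<le> 1" "z \<noteq> x" using assms that by auto
    then show ?thesis
      using Re_one_minus_cnj_mult_pos[of x z] assms(1)
      by (auto simp: complex_nonpos_Reals_iff)
  qed
  then show ?thesis by (intro continuous_intros) auto
qed

lemma exp_Ln_one_minus_cnj_mult:
  assumes "norm x = 1" "norm z \<le> 1" "z \<noteq> x"
  shows "exp (Ln (1 - cnj x * z)) = cnj x * (x - z)"
proof -
  have "1 - cnj x * z \<noteq> 0"
    using Re_one_minus_cnj_mult_pos[OF assms] by force
  moreover have "cnj x * x = 1"
    using assms(1) by (simp add: mult.commute mult_cnj_norm_1)
  ultimately show ?thesis by (simp add: algebra_simps)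
qed

text \<open>A disc minus a boundary point \<open>x\<close> carries a branch of \<open>log (z - x)\<close>.\<close>

lemma winding_number_disc_boundary_point:
  assumes p: "path p" "path_image p \<subseteq> cball 0 1" and x: "norm x = 1" "x \<notin> path_image p"
  shows "2 * of_real pi * \<i> * winding_number p x =
         Ln (1 - cnj x * pathfinish p) - Ln (1 - cnj x * pathstart p)"
proof -
  obtain q where q: "path q" "pathfinish q - pathstart q = 2 * of_real pi * \<i> * winding_number p x"
      "\<And>t. t \<in> {0..1} \<Longrightarrow> p t = x + exp (q t)"
    using winding_number_as_continuous_log[OF p(1) x(2)] by blast
  have pt: "p t \<in> cball 0 1" "p t \<noteq> x" if "t \<in> {0..1}" for t
  proof -
    have "p t \<in> path_image p" using that by (simp add: path_image_def)
    then show "p t \<in> cball 0 1" "p t \<noteq> x" using p(2) x(2) by auto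
  qed
  \<comment> \<open>Both terms are logarithms of \<open>p t - x\<close> up to a constant
    factor.\<close>
  define f where "f = (\<lambda>t. q t - Ln (1 - cnj x * p t))"
  have "continuous_on {0..1} (\<lambda>t. Ln (1 - cnj x * p t))"
  proof (rule continuous_on_compose2[OF continuous_on_Ln_one_minus_cnj_mult[of x "path_image p"]])
    show "continuous_on {0..1} p" using p(1) by (simp add: path_def)
  qed (use p x in \<open>auto simp: path_image_def\<close>)
  then have "continuous_on {0..1} f"
    unfolding f_def using q(1) by (intro continuous_on_diff) (auto simp: path_def)
  moreover have "exp (f t) = - x" if "t \<in> {0..1}" for t
  proof -
    have "exp (q t) = p t - x" using q(3)[OF that] by simp
    moreover have "exp (Ln (1 - cnj x * p t)) = cnj x * (x - p t)"
      using exp_Ln_one_minus_cnj_mult x pt[OF that] by simp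
    moreover have "cnj x * x = 1"
      using x(1) by (simp add: mult.commute mult_cnj_norm_1)
    ultimately show ?thesis
      using pt(2)[OF that] unfolding f_def exp_diff
      by (simp add: divide_simps) (metis \<open>cnj x * x = 1\<close> minus_diff_eq mult.assoc mult.commute mult.right_neutral mult_minus_right mult_zero_left zero_neq_one)
  qed
  ultimately have "f 1 = f 0"
    by (intro continuous_on_exp_constant_eq[of "{0..1}" f "- x"]) auto
  then show ?thesis
    using q(2) unfolding f_def pathfinish_def pathstart_def by (simp add: algebra_simps)
qed

text \<open>For a path from \<open>v\<close> to \<open>b\<close>,
  \<open>exp (2 * pi * \<i> * w)\<close> at \<open>z\<close> is \<open>(b - z) / (v - z)\<close>.
  The common start cancels in the difference of winding numbers, and the \<open>Ln\<close> terms
  remove what depends on the two ends, up to a constant. So \<open>exp \<circ> K\<close> is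
  constant; \<open>K\<close> is continuous on \<open>g\<close> because \<open>g\<close> avoids both
  paths.\<close>

lemma winding_number_diff_along_path:
  assumes g: "path g" "path_image g \<subseteq> cball 0 1"
    and h: "path h" "path h'" "pathstart h = pathstart h'"
    and x: "norm (pathfinish h) = 1" "norm (pathfinish h') = 1"
    and disj: "path_image g \<inter> path_image h = {}" "path_image g \<inter> path_image h' = {}"
    and zz: "z \<in> path_image g" "z' \<in> path_image g"
  defines "K \<equiv> \<lambda>z. 2 * of_real pi * \<i> * (winding_number h z - winding_number h' z)
                 - Ln (1 - cnj (pathfinish h) * z) + Ln (1 - cnj (pathfinish h') * z)"
  shows "K z = K z'"
proof (rule continuous_on_exp_constant_eq[OF _ _ _ zz])
  show "connected (path_image g)" using g by (simp add: connected_path_image)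
  have ne: "pathfinish h \<notin> path_image g" "pathfinish h' \<notin> path_image g"
    using disj by auto
  have "continuous_on (path_image g) (winding_number h)" "continuous_on (path_image g) (winding_number h')"
    using continuous_on_winding_number[of h] continuous_on_winding_number[of h'] h disj
    by (auto elim!: continuous_on_subset)
  moreover have "continuous_on (path_image g) (\<lambda>z. Ln (1 - cnj (pathfinish h) * z))"
    "continuous_on (path_image g) (\<lambda>z. Ln (1 - cnj (pathfinish h') * z))"
    using continuous_on_Ln_one_minus_cnj_mult g x ne by auto
  ultimately show "continuous_on (path_image g) K"
    unfolding K_def
    by (intro continuous_on_add continuous_on_diff continuous_on_mult continuous_on_const)
  fix z assume z: "z \<in> path_image g"
  have *: "z \<notin> path_image h" "z \<notin> path_image h'" using disj z by auto
  define b c v where "b = pathfinish h" and "c = pathfinish h'" and "v = pathstart h'"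
  have w: "b - z = exp (2 * of_real pi * \<i> * winding_number h z) * (v - z)"
    "c - z = exp (2 * of_real pi * \<i> * winding_number h' z) * (v - z)"
    using winding_number_exp_2pi[of h z] winding_number_exp_2pi[of h' z] * h
    by (auto simp: b_def c_def v_def)
  have nz: "b \<noteq> z" "c \<noteq> z" "v \<noteq> z"
    using * h by (auto simp: b_def c_def v_def)
  have l: "exp (Ln (1 - cnj b * z)) = cnj b * (b - z)" "exp (Ln (1 - cnj c * z)) = cnj c * (c - z)"
    using exp_Ln_one_minus_cnj_mult[of b z] exp_Ln_one_minus_cnj_mult[of c z] x nz g z
    by (auto simp: b_def c_def)
  have nz2: "b \<noteq> 0" "c \<noteq> 0" using x by (auto simp: b_def c_def)
  have "exp (K z) = exp (2 * of_real pi * \<i> * winding_number h z) / exp (2 * of_real pi * \<i> * winding_number h' z)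
          / exp (Ln (1 - cnj b * z)) * exp (Ln (1 - cnj c * z))"
    unfolding K_def b_def[symmetric] c_def[symmetric] by (simp add: exp_add exp_diff right_diff_distrib)
  also have "\<dots> = ((b - z) / (v - z)) / ((c - z) / (v - z)) / (cnj b * (b - z)) * (cnj c * (c - z))"
    unfolding l w using nz by simp
  also have "\<dots> = cnj c / cnj b"
    using nz nz2 by (simp add: divide_simps)
  finally show "exp (K z) = cnj (pathfinish h') / cnj (pathfinish h)"
    by (simp add: b_def c_def)
qed

text \<open>The product of the three arguments of \<open>Ln\<close> is purely imaginary.\<close>

lemma Im_Ln_one_minus_cnj_mult_sum_nonzero:
  assumes n: "norm x = 1" "norm y = 1" "norm z = 1" and d: "x \<noteq> y" "y \<noteq> z" "z \<noteq> x"
  shows "Im (Ln (1 - cnj x * y)) + Im (Ln (1 - cnj y * z)) + Im (Ln (1 - cnj z * x)) \<noteq> 0"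
proof
  let ?a = "1 - cnj x * y" and ?b = "1 - cnj y * z" and ?c = "1 - cnj z * x"
  assume 0: "Im (Ln ?a) + Im (Ln ?b) + Im (Ln ?c) = 0"
  have nz: "?a \<noteq> 0" "?b \<noteq> 0" "?c \<noteq> 0"
    using Re_one_minus_cnj_mult_pos[of x y] Re_one_minus_cnj_mult_pos[of y z]
      Re_one_minus_cnj_mult_pos[of z x] n d by force+
  have "exp (Ln ?a + Ln ?b + Ln ?c) = ?a * ?b * ?c"
    using nz by (simp add: exp_add)
  moreover have "Ln ?a + Ln ?b + Ln ?c = of_real (Re (Ln ?a + Ln ?b + Ln ?c))"
    using 0 by (simp add: complex_eq_iff)
  ultimately have "?a * ?b * ?c = of_real (exp (Re (Ln ?a + Ln ?b + Ln ?c)))"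
    by (metis exp_of_real)
  then have pos: "Re (?a * ?b * ?c) > 0" by simp
  have u: "x * cnj x = 1" "y * cnj y = 1" "z * cnj z = 1"
    using n by (simp_all add: mult_cnj_norm_1)
  have "?a * ?b * ?c = (cnj x * z + cnj y * x + cnj z * y) - cnj (cnj x * z + cnj y * x + cnj z * y)"
    using u by simp algebra
  then have "Re (?a * ?b * ?c) = 0" by simp
  with pos show False by simp
qed

text \<open>
  With \<open>w\<^sub>b\<close> the (nonintegral) winding number of \<open>h b\<close> and \<open>l\<^sub>b(z) = Ln (1 - cnj (x b) * z)\<close>, the quantity
  \<open>2\<pi>\<i>(w\<^sub>b - w\<^sub>c) - l\<^sub>b + l\<^sub>c\<close> is constant along \<open>g a\<close>.  Its values at the common starting point \<open>u\<close>
  cancel cyclically, while at \<open>x a\<close> it is determined by inscribed angles of the triangle \<open>x\<close>,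
  whose sum does not vanish.
\<close>

lemma two_stars_in_disc_cross:
  fixes g h :: "nat \<Rightarrow> real \<Rightarrow> complex" and x :: "nat \<Rightarrow> complex"
  assumes g: "\<And>a. a < 3 \<Longrightarrow> path (g a) \<and> path_image (g a) \<subseteq> cball 0 1 \<and> pathstart (g a) = u \<and> pathfinish (g a) = x a"
    and h: "\<And>a. a < 3 \<Longrightarrow> path (h a) \<and> path_image (h a) \<subseteq> cball 0 1 \<and> pathstart (h a) = v \<and> pathfinish (h a) = x a"
    and x: "\<And>a. a < 3 \<Longrightarrow> norm (x a) = 1"
  shows "\<exists>a<3. \<exists>b<3. a \<noteq> b \<and> path_image (g a) \<inter> path_image (h b) \<noteq> {}"
proof (rule ccontr)
  assume "\<not> ?thesis"
  then have disj: "path_image (g a) \<inter> path_image (h b) = {}" if "a < 3" "b < 3" "a \<noteq> b" for a b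
    using that by blast
  have xg: "x a \<in> path_image (g a)" "u \<in> path_image (g a)" "x a \<in> path_image (h a)" "v \<in> path_image (h a)" if "a < 3" for a
    using g[OF that] h[OF that] by (metis pathfinish_in_path_image pathstart_in_path_image)+
  have ne: "x a \<noteq> x b" if "a < 3" "b < 3" "a \<noteq> b" for a b
    using disj[OF that] xg that by (metis IntI empty_iff)
  define l where "l = (\<lambda>a z. Ln (1 - cnj (x a) * z))"
  define w where "w = (\<lambda>b z. 2 * of_real pi * \<i> * winding_number (h b) z)"
  have A: "w b u - w c u - l b u + l c u = l a (x b) - l a (x c) - l b (x a) + l c (x a)"
    if abc: "a < 3" "b < 3" "c < 3" "a \<noteq> b" "a \<noteq> c" for a b c
  proof -
    have "w b u - w c u - l b u + l c u = w b (x a) - w c (x a) - l b (x a) + l c (x a)"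
      using winding_number_diff_along_path[of "g a" "h b" "h c" u "x a"] g h x disj abc xg
      by (simp add: w_def l_def right_diff_distrib)
    \<comment> \<open>\<open>x a\<close> is on the unit circle and off \<open>h d\<close>, so its
      logarithm branch gives the winding number from the ends of \<open>h d\<close> alone;
      \<open>l a v\<close> is the same for \<open>d = b\<close> and \<open>d = c\<close> and
      cancels.\<close>
    moreover have "w d (x a) = l a (x d) - l a v" if "d < 3" "d \<noteq> a" for d
    proof -
      have "x a \<notin> path_image (h d)" using disj[of a d] xg[of a] that abc by auto
      then show ?thesis
        using winding_number_disc_boundary_point[of "h d" "x a"] h[of d] x[of a] that abc
        by (simp add: w_def l_def)
    qed
    ultimately show ?thesis using abc by auto
  qed
  \<comment> \<open>The arguments of the two logarithms are complex conjugates.\<close>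
  have conj: "l a (x b) - l b (x a) = 2 * \<i> * Im (l a (x b))" if "a < 3" "b < 3" "a \<noteq> b" for a b
  proof -
    have "Re (1 - cnj (x a) * x b) > 0"
      using Re_one_minus_cnj_mult_pos x ne that by simp
    then have "cnj (Ln (1 - cnj (x a) * x b)) = Ln (cnj (1 - cnj (x a) * x b))"
      by (intro cnj_Ln) (auto simp: complex_nonpos_Reals_iff)
    then have "l b (x a) = cnj (l a (x b))"
      by (simp add: l_def mult.commute)
    then show ?thesis by (simp add: complex_eq_iff)
  qed
  have 012: "(0::nat) < 3" "(1::nat) < 3" "(2::nat) < 3" "(0::nat) \<noteq> 1" "(1::nat) \<noteq> 2" "(0::nat) \<noteq> 2"
    "(1::nat) \<noteq> 0" "(2::nat) \<noteq> 1" "(2::nat) \<noteq> 0" by auto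
  \<comment> \<open>Sum of \<open>A\<close> over the rotations of \<open>(0, 1, 2)\<close>: each
    difference of \<open>l\<close> occurs twice among the values at the \<open>x a\<close>, while
    the values at \<open>u\<close> telescope.\<close>
  have "2 * ((l 0 (x 1) - l 1 (x 0)) + (l 1 (x 2) - l 2 (x 1)) + (l 2 (x 0) - l 0 (x 2)))
      = (w 1 u - w 2 u - l 1 u + l 2 u) + (w 2 u - w 0 u - l 2 u + l 0 u) + (w 0 u - w 1 u - l 0 u + l 1 u)"
    unfolding A[OF 012(1,2,3,4,6)] A[OF 012(2,3,1,5,7)] A[OF 012(3,1,2,9,8)]
    by (simp add: algebra_simps)
  also have "\<dots> = 2 * 0" by simp
  finally have "(l 0 (x 1) - l 1 (x 0)) + (l 1 (x 2) - l 2 (x 1)) + (l 2 (x 0) - l 0 (x 2)) = 0"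
    by (subst (asm) mult_cancel_left) simp
  then have "2 * \<i> * (Im (l 0 (x 1)) + Im (l 1 (x 2)) + Im (l 2 (x 0))) = 0"
    unfolding conj[OF 012(1,2,4)] conj[OF 012(2,3,5)] conj[OF 012(3,1,9)]
    by (simp only: distrib_left of_real_add)
  then have "complex_of_real (Im (l 0 (x 1)) + Im (l 1 (x 2)) + Im (l 2 (x 0))) = 0"
    by simp
  then have "Im (l 0 (x 1)) + Im (l 1 (x 2)) + Im (l 2 (x 0)) = 0"
    using of_real_eq_0_iff by blast
  then show False
    using Im_Ln_one_minus_cnj_mult_sum_nonzero[of "x 0" "x 1" "x 2"] x ne
    by (simp add: l_def)
qed

text \<open>Mantel's induction, run on the complement of the triangle-free graph of pairs violating
  \<open>P\<close>: delete a violating pair \<open>x\<close>, \<open>y\<close>; every other vertex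
  is \<open>P\<close>-related to \<open>x\<close> or \<open>y\<close>, which yields
  \<open>card V - 2\<close> further pairs. If no pair violates \<open>P\<close>, all pairs
  count.\<close>

lemma mantel_complement:
  assumes "finite V" and sym: "\<And>x y. P x y \<Longrightarrow> P y x"
    and triple: "\<And>x y z. x \<in> V \<Longrightarrow> y \<in> V \<Longrightarrow> z \<in> V \<Longrightarrow> x \<noteq> y \<Longrightarrow> y \<noteq> z \<Longrightarrow> x \<noteq> z \<Longrightarrow> P x y \<or> P y z \<or> P x z"
  shows "((card V - 1) div 2) * (card V div 2) \<le> card {{x, y} | x y. x \<in> V \<and> y \<in> V \<and> x \<noteq> y \<and> P x y}"
  using assms(1,3)
proof (induction "card V" arbitrary: V rule: less_induct)
  case less
  let ?E = "\<lambda>V. {{x, y} | x y. x \<in> V \<and> y \<in> V \<and> x \<noteq> y \<and> P x y}"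
  have finE: "finite (?E U)" if "finite U" for U
    by (rule finite_subset[of _ "Pow U"]) (use that in auto)
  show ?case
  proof (cases "\<exists>x\<in>V. \<exists>y\<in>V. x \<noteq> y \<and> \<not> P x y")
    case True
    then obtain x y where xy: "x \<in> V" "y \<in> V" "x \<noteq> y" "\<not> P x y" by blast
    define U where "U = V - {x, y}"
    have cV: "card V = card U + 2"
      using xy less.prems(1) card_mono[of V "{x,y}"] by (simp add: U_def card_Diff_subset)
    have IH: "((card U - 1) div 2) * (card U div 2) \<le> card (?E U)"
      using less.prems cV by (intro less.hyps) (auto simp: U_def)
    \<comment> \<open>\<open>s z\<close> contains exactly one vertex of \<open>U\<close>, whence
      injectivity and disjointness from the pairs inside \<open>U\<close>.\<close>
    define s where "s = (\<lambda>z. {z, if P z x then x else y})"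
    have inj: "inj_on s U"
      by (auto simp: inj_on_def s_def U_def doubleton_eq_iff split: if_splits)
    have Pz: "P z x \<or> P z y" if "z \<in> U" for z
      using less.prems(2)[of x y z] xy that sym by (auto simp: U_def)
    have sub: "?E U \<union> s ` U \<subseteq> ?E V"
    proof
      fix e assume "e \<in> ?E U \<union> s ` U"
      then show "e \<in> ?E V"
      proof
        assume "e \<in> s ` U"
        then obtain z where z: "z \<in> U" "e = s z" by auto
        define w where "w = (if P z x then x else y)"
        have "z \<in> V" "w \<in> V" "z \<noteq> w" "P z w"
          using z xy Pz[OF z(1)] by (auto simp: w_def U_def)
        moreover have "e = {z, w}" using z by (simp add: s_def w_def)
        ultimately show ?thesis by blast
      qed (auto simp: U_def)
    qed
    have disj: "?E U \<inter> s ` U = {}"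
      by (auto simp: s_def U_def doubleton_eq_iff split: if_splits)
    have finU: "finite U" using less.prems(1) by (simp add: U_def)
    have "card (?E U) + card U = card (?E U \<union> s ` U)"
      using disj finE[OF finU] finU inj by (simp add: card_Un_disjoint card_image)
    also have "\<dots> \<le> card (?E V)"
      using sub finE[OF less.prems(1)] by (rule card_mono[rotated])
    finally have "card (?E U) + card U \<le> card (?E V)" .
    moreover have "((n + 2 - 1) div 2) * ((n + 2) div 2) = ((n - 1) div 2) * (n div 2) + n" for n :: nat
    proof (cases "even n")
      case True
      then obtain k where n: "n = 2 * k" by blast
      show ?thesis unfolding n by (cases k) (simp_all add: algebra_simps)
    next
      case False
      then obtain k where n: "n = 2 * k + 1" using oddE by blast
      show ?thesis unfolding n by (simp add: algebra_simps)
    qed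
    ultimately show ?thesis using IH cV by simp
  next
    case False
    then have "?E V = {e. e \<subseteq> V \<and> card e = 2}"
      by (auto simp: card_2_iff) blast
    then have "card (?E V) = card V choose 2"
      using n_subsets[OF less.prems(1)] by simp
    moreover have "((n - 1) div 2) * (n div 2) \<le> n choose 2" for n :: nat
    proof -
      have "((n - 1) div 2) * (n div 2) * 2 \<le> (n - 1) * n"
        using mult_mono[of "((n - 1) div 2) * 2" "n - 1" "n div 2" n] by simp
      then show ?thesis by (simp add: choose_two mult.commute)
    qed
    ultimately show ?thesis by simp
  qed
qed

subsection \<open>Stars at a circle\<close>

text \<open>By injectivity the arc without its final point misses the sphere; this part is
  connected, so it stays on one side, and the final point lies in its closure.\<close>

lemma path_on_one_side_of_sphere:
  fixes g :: "real \<Rightarrow> complex"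
  assumes g: "arc g" "path_image g \<inter> sphere c r \<subseteq> {pathfinish g}" "r > 0"
  shows "dist c (pathstart g) < r \<Longrightarrow> path_image g \<subseteq> cball c r"
    and "dist c (pathstart g) > r \<Longrightarrow> path_image g \<subseteq> - ball c r"
proof -
  define S where "S = g ` {0..<1}"
  have S: "path_image g = insert (pathfinish g) S" 
  proof -
    have "{0..1::real} = insert 1 {0..<1}" by auto
    then show ?thesis by (simp add: path_image_def S_def pathfinish_def)
  qed
  have "pathfinish g \<notin> S"
    using arcD[OF g(1)] by (force simp: S_def pathfinish_def)
  then have S0: "S \<inter> sphere c r = {}" using g(2) S by auto
  have conn: "connected S"
    unfolding S_def using arc_imp_path[OF g(1)]
    by (intro connected_continuous_image) (auto simp: path_def intro: continuous_on_subset)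
  have st: "pathstart g \<in> S" by (simp add: S_def pathstart_def)
  have clS: "path_image g \<subseteq> closure S"
  proof -
    have "path_image g = g ` closure {0..<1}" by (simp add: path_image_def)
    also have "\<dots> \<subseteq> closure S"
      unfolding S_def using arc_imp_path[OF g(1)]
      by (intro image_closure_subset) (auto simp: path_def closure_subset)
    finally show ?thesis .
  qed
  have fr: "frontier (ball c r) = sphere c r" using g(3) by simp
  have side: "S \<subseteq> ball c r \<or> S \<subseteq> - ball c r"
    using connected_Int_frontier[OF conn, of "ball c r"] S0 fr by auto
  show "path_image g \<subseteq> cball c r" if "dist c (pathstart g) < r"
  proof -
    have "S \<subseteq> cball c r" using side st that by auto
    then show ?thesis using clS closure_minimal[OF _ closed_cball] by blast
  qed
  show "path_image g \<subseteq> - ball c r" if "dist c (pathstart g) > r"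
  proof -
    have "S \<subseteq> - ball c r" using side st that by auto
    moreover have "closed (- ball c r)" by (simp add: closed_Compl)
    ultimately show ?thesis using clS closure_minimal by blast
  qed
qed

lemma two_stars_at_circle_cross:
  fixes g h :: "nat \<Rightarrow> real \<Rightarrow> complex" and x :: "nat \<Rightarrow> complex"
  assumes g: "\<And>a. a < 3 \<Longrightarrow> arc (g a) \<and> pathstart (g a) = u \<and> pathfinish (g a) = x a
                 \<and> path_image (g a) \<inter> sphere c r \<subseteq> {x a}"
    and h: "\<And>a. a < 3 \<Longrightarrow> arc (h a) \<and> pathstart (h a) = v \<and> pathfinish (h a) = x a
                 \<and> path_image (h a) \<inter> sphere c r \<subseteq> {x a}"
    and r: "r > 0" and x: "\<And>a. a < 3 \<Longrightarrow> x a \<in> sphere c r"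
    and e: "path e" "pathstart e = u" "pathfinish e = v" "path_image e \<inter> sphere c r = {}"
  shows "\<exists>a<3. \<exists>b<3. a \<noteq> b \<and> path_image (g a) \<inter> path_image (h b) \<noteq> {}"
proof -
  have "u \<in> path_image e" "v \<in> path_image e" using e by auto
  moreover have "path_image e \<subseteq> ball c r \<or> path_image e \<inter> ball c r = {}"
    using e(4) connected_Int_frontier[of "path_image e" "ball c r"] connected_path_image[OF e(1)] r
    by auto
  ultimately have uv: "u \<notin> sphere c r" "v \<notin> sphere c r" "u \<in> ball c r \<longleftrightarrow> v \<in> ball c r"
    using e(4) by blast+
  \<comment> \<open>Intersections are pulled back along any injection, so continuity and injectivity
    of \<open>T\<close> on the side containing both stars suffice.\<close>
  obtain T :: "complex \<Rightarrow> complex" and D where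
    D: "\<And>a. a < 3 \<Longrightarrow> path_image (g a) \<subseteq> D" "\<And>a. a < 3 \<Longrightarrow> path_image (h a) \<subseteq> D"
    and T: "continuous_on D T" "inj_on T D" "T ` D \<subseteq> cball 0 1" "\<And>z. z \<in> sphere c r \<Longrightarrow> norm (T z) = 1"
  proof (cases "u \<in> ball c r")
    case True
    show ?thesis
    proof (rule that[of "cball c r" "\<lambda>z. (z - c) / of_real r"])
      show "path_image (g a) \<subseteq> cball c r" "path_image (h a) \<subseteq> cball c r" if "a < 3" for a
        using path_on_one_side_of_sphere(1)[of "g a" c r] path_on_one_side_of_sphere(1)[of "h a" c r]
          g[OF that] h[OF that] uv True r by auto
      show "continuous_on (cball c r) (\<lambda>z. (z - c) / of_real r)"
        using r by (intro continuous_intros) auto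
    qed (use r in \<open>auto simp: inj_on_def norm_divide dist_norm norm_minus_commute divide_simps\<close>)
  next
    case False
    show ?thesis
    \<comment> \<open>The pole \<open>c\<close> lies in the open ball, hence outside the
      domain.\<close>
    proof (rule that[of "- ball c r" "\<lambda>z. of_real r / (z - c)"])
      show "path_image (g a) \<subseteq> - ball c r" "path_image (h a) \<subseteq> - ball c r" if "a < 3" for a
        using path_on_one_side_of_sphere(2)[of "g a" c r] path_on_one_side_of_sphere(2)[of "h a" c r]
          g[OF that] h[OF that] uv False r by auto
      show "continuous_on (- ball c r) (\<lambda>z. of_real r / (z - c))"
        using r by (intro continuous_intros) auto
    qed (use r in \<open>auto simp: inj_on_def norm_divide dist_norm norm_minus_commute divide_simps\<close>)
  qed
  have "\<exists>a<3. \<exists>b<3. a \<noteq> b \<and> path_image (T \<circ> g a) \<inter> path_image (T \<circ> h b) \<noteq> {}"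
  proof (rule two_stars_in_disc_cross[where u = "T u" and v = "T v" and x = "T \<circ> x"])
    fix a :: nat assume a: "a < 3"
    have pT: "path (T \<circ> f)" if "arc f" "path_image f \<subseteq> D" for f
      using that T(1) by (intro path_continuous_image arc_imp_path) (auto intro: continuous_on_subset)
    show "path (T \<circ> g a) \<and> path_image (T \<circ> g a) \<subseteq> cball 0 1 \<and> pathstart (T \<circ> g a) = T u \<and> pathfinish (T \<circ> g a) = (T \<circ> x) a"
      using g[OF a] D[OF a] T(3) pT[of "g a"]
      by (auto simp: pathstart_compose pathfinish_compose path_image_compose)
    show "path (T \<circ> h a) \<and> path_image (T \<circ> h a) \<subseteq> cball 0 1 \<and> pathstart (T \<circ> h a) = T v \<and> pathfinish (T \<circ> h a) = (T \<circ> x) a"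
      using h[OF a] D[OF a] T(3) pT[of "h a"]
      by (auto simp: pathstart_compose pathfinish_compose path_image_compose)
    show "norm ((T \<circ> x) a) = 1" using T(4) x[OF a] by simp
  qed
  then obtain a b where ab: "a < 3" "b < 3" "a \<noteq> b" "T ` path_image (g a) \<inter> T ` path_image (h b) \<noteq> {}"
    by (auto simp: path_image_compose)
  then have "path_image (g a) \<inter> path_image (h b) \<noteq> {}"
    using T(2) D(1)[of a] D(2)[of b] by (auto simp: inj_on_def) blast
  then show ?thesis using ab by blast
qed

subsection \<open>Crossings between two sets of edges\<close>

definition bip_edges :: "nat list \<Rightarrow> nat \<Rightarrow> nat \<Rightarrow> (nat \<times> nat) set set" where
  "bip_edges ns k l = {{(k, i), (l, j)} | i j. i < ns ! k \<and> j < ns ! l}"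

definition cross_between ::
    "'v set set \<Rightarrow> 'v set set \<Rightarrow> ('v set \<Rightarrow> real \<Rightarrow> complex) \<Rightarrow> ('v set set \<times> complex) set" where
  "cross_between E F \<gamma> = {({e, f}, x) | e f x. e \<in> E \<and> f \<in> F \<and> e \<noteq> f \<and>
                                x \<in> path_interior (\<gamma> e) \<inter> path_interior (\<gamma> f)}"

lemma crossings_eq: "crossings E \<gamma> = card (cross_between E E \<gamma>)"
  by (simp add: crossings_def cross_between_def)

lemma doubleton_eqD:
  assumes "{a, b} = {c, d}" "a \<noteq> d"
  shows "a = c" "b = d"
  using assms by (auto simp: doubleton_eq_iff)

lemma cross_betweenE:
  assumes "p \<in> cross_between E F \<gamma>"
  obtains e f x where "p = ({e, f}, x)" "e \<in> E" "f \<in> F" "e \<noteq> f"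
    "x \<in> path_interior (\<gamma> e)" "x \<in> path_interior (\<gamma> f)"
  using assms unfolding cross_between_def by blast

lemma cross_betweenI:
  "e \<in> E \<Longrightarrow> f \<in> F \<Longrightarrow> e \<noteq> f \<Longrightarrow> x \<in> path_interior (\<gamma> e) \<Longrightarrow> x \<in> path_interior (\<gamma> f)
    \<Longrightarrow> ({e, f}, x) \<in> cross_between E F \<gamma>"
  unfolding cross_between_def by blast

lemma cross_between_mono: "E \<subseteq> E' \<Longrightarrow> F \<subseteq> F' \<Longrightarrow> cross_between E F \<gamma> \<subseteq> cross_between E' F' \<gamma>"
  unfolding cross_between_def by blast

lemma finite_multipartite_edges: "finite (multipartite_edges ns)"
proof -
  have "finite (multipartite_verts ns)" by (simp add: multipartite_verts_def)
  then show ?thesis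
    by (rule finite_subset[rotated, OF finite_Pow_iff[THEN iffD2]]) (auto simp: multipartite_edges_def)
qed

lemma bip_edges_image:
  "bip_edges ns k l = (\<lambda>(i, j). {(k, i), (l, j)}) ` ({..<ns ! k} \<times> {..<ns ! l})"
  unfolding bip_edges_def by auto

lemma bip_edges_subset:
  "k < length ns \<Longrightarrow> l < length ns \<Longrightarrow> k \<noteq> l \<Longrightarrow> bip_edges ns k l \<subseteq> multipartite_edges ns"
  by (fastforce simp: bip_edges_def multipartite_edges_def multipartite_verts_def)

lemma multipartite_edges_2: "multipartite_edges [a, b] = bip_edges [a, b] 0 1"
proof
  show "bip_edges [a, b] 0 1 \<subseteq> multipartite_edges [a, b]" by (rule bip_edges_subset) auto
  show "multipartite_edges [a, b] \<subseteq> bip_edges [a, b] 0 1"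
  proof
    fix e assume "e \<in> multipartite_edges [a, b]"
    then obtain i i' j j' where e: "e = {(i, i'), (j, j')}" "i < 2" "j < 2" "i \<noteq> j"
      "i' < [a, b] ! i" "j' < [a, b] ! j"
      by (auto simp: multipartite_edges_def multipartite_verts_def)
    then consider "i = 0" "j = 1" | "i = 1" "j = 0" by linarith
    then show "e \<in> bip_edges [a, b] 0 1"
    proof cases
      case 1
      then show ?thesis using e unfolding bip_edges_def by blast
    next
      case 2
      then have "e = {(0, j'), (1, i')}" "i' < [a, b] ! 1" "j' < [a, b] ! 0"
        using e by (auto simp: insert_commute)
      then show ?thesis unfolding bip_edges_def by blast
    qed
  qed
qed

lemma finite_cross_between:
  assumes "finite E" "\<And>e f. e \<in> E \<Longrightarrow> f \<in> E \<Longrightarrow> e \<noteq> f \<Longrightarrow> finite (path_image (\<gamma> e) \<inter> path_image (\<gamma> f))"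
  shows "finite (cross_between E E \<gamma>)"
proof -
  have "cross_between E E \<gamma> \<subseteq>
      (\<Union>e\<in>E. \<Union>f\<in>E - {e}. Pair {e, f} ` (path_image (\<gamma> e) \<inter> path_image (\<gamma> f)))"
    unfolding cross_between_def path_interior_def by auto
  then show ?thesis
    by (rule finite_subset) (use assms in \<open>auto intro!: finite_UN_I\<close>)
qed

lemma partite_circle_cr_le:
  "partite_circle_drawing ns pos \<gamma> \<Longrightarrow> partite_circle_cr ns \<le> enat (crossings (multipartite_edges ns) \<gamma>)"
  unfolding partite_circle_cr_def by (rule Inf_lower) blast

section \<open>Restricting a drawing to two of its parts\<close>

lemma cross_between_image:
  assumes "inj_on r E"
  shows "card (cross_between E E (\<gamma> \<circ> r)) = card (cross_between (r ` E) (r ` E) \<gamma>)"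
proof -
  have "bij_betw (map_prod ((`) r) id) (cross_between E E (\<gamma> \<circ> r)) (cross_between (r ` E) (r ` E) \<gamma>)"
  proof (rule bij_betw_imageI)
    have sub: "fst ` cross_between E E (\<gamma> \<circ> r) \<subseteq> Pow E"
      by (auto simp: cross_between_def)
    show "inj_on (map_prod ((`) r) id) (cross_between E E (\<gamma> \<circ> r))"
    proof (rule inj_onI)
      fix p q assume *: "p \<in> cross_between E E (\<gamma> \<circ> r)" "q \<in> cross_between E E (\<gamma> \<circ> r)"
        "map_prod ((`) r) id p = map_prod ((`) r) id q"
      have "fst p \<subseteq> E" "fst q \<subseteq> E" using sub *(1,2) by blast+
      moreover have "r ` fst p = r ` fst q"
        using *(3) by (auto simp: map_prod_def split: prod.splits)
      ultimately have "fst p = fst q" using inj_on_image_eq_iff[OF assms] by simp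
      then show "p = q" using *(3) by (auto simp: map_prod_def prod_eq_iff split: prod.splits)
    qed
    show "map_prod ((`) r) id ` cross_between E E (\<gamma> \<circ> r) = cross_between (r ` E) (r ` E) \<gamma>"
    proof
      show "map_prod ((`) r) id ` cross_between E E (\<gamma> \<circ> r) \<subseteq> cross_between (r ` E) (r ` E) \<gamma>"
      proof
        fix p assume "p \<in> map_prod ((`) r) id ` cross_between E E (\<gamma> \<circ> r)"
        then obtain q where q: "q \<in> cross_between E E (\<gamma> \<circ> r)" "p = map_prod ((`) r) id q"
          by (elim imageE)
        from q(1) obtain e f x where ef: "q = ({e, f}, x)" "e \<in> E" "f \<in> E" "e \<noteq> f"
          "x \<in> path_interior ((\<gamma> \<circ> r) e)" "x \<in> path_interior ((\<gamma> \<circ> r) f)"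
          by (rule cross_betweenE)
        then have "r e \<noteq> r f" using inj_onD[OF assms] by blast
        then have "({r e, r f}, x) \<in> cross_between (r ` E) (r ` E) \<gamma>"
          using ef by (intro cross_betweenI) auto
        then show "p \<in> cross_between (r ` E) (r ` E) \<gamma>" using q(2) ef(1) by simp
      qed
      show "cross_between (r ` E) (r ` E) \<gamma> \<subseteq> map_prod ((`) r) id ` cross_between E E (\<gamma> \<circ> r)"
      proof
        fix p assume "p \<in> cross_between (r ` E) (r ` E) \<gamma>"
        then obtain e' f' x where ef: "p = ({e', f'}, x)" "e' \<in> r ` E" "f' \<in> r ` E" "e' \<noteq> f'"
          "x \<in> path_interior (\<gamma> e')" "x \<in> path_interior (\<gamma> f')"
          by (rule cross_betweenE)
        then obtain e f where "e \<in> E" "f \<in> E" "e' = r e" "f' = r f" by blast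
        with ef have "({e, f}, x) \<in> cross_between E E (\<gamma> \<circ> r)" "p = map_prod ((`) r) id ({e, f}, x)"
          by (auto intro!: cross_betweenI)
        then show "p \<in> map_prod ((`) r) id ` cross_between E E (\<gamma> \<circ> r)" by blast
      qed
    qed
  qed
  then show ?thesis by (rule bij_betw_same_card)
qed

text \<open>The drawing is pulled back along \<open>r\<close>, which sends the parts 0 and 1 to
  \<open>k\<close> and \<open>l\<close>.\<close>

lemma partite_circle_cr_bipartite_le:
  assumes d: "partite_circle_drawing ns pos \<gamma>" and kl: "k < length ns" "l < length ns" "k \<noteq> l"
  shows "partite_circle_cr [ns ! k, ns ! l] \<le> enat (crossings (bip_edges ns k l) \<gamma>)"
proof -
  define r :: "nat \<times> nat \<Rightarrow> nat \<times> nat" where "r = (\<lambda>(i, j). (if i = 0 then k else l, j))"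
  let ?ns = "[ns ! k, ns ! l]"
  have r_verts: "r ` multipartite_verts ?ns \<subseteq> multipartite_verts ns"
    using kl by (auto simp: r_def multipartite_verts_def nth_Cons' split: if_splits)
  have r_inj: "inj_on r (multipartite_verts ?ns)"
    using kl by (auto simp: r_def multipartite_verts_def inj_on_def split: if_splits)
  have r_edges: "(`) r ` multipartite_edges ?ns = bip_edges ns k l"
  proof -
    have "(`) r ` bip_edges ?ns 0 1 = bip_edges ns k l"
      by (auto simp: bip_edges_image image_image r_def split_def)
    then show ?thesis by (simp add: multipartite_edges_2)
  qed
  have edge_sub: "e \<subseteq> multipartite_verts ?ns" if "e \<in> multipartite_edges ?ns" for e
    using that by (auto simp: multipartite_edges_def)
  have r_inj_edges: "inj_on ((`) r) (multipartite_edges ?ns)"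
    using inj_on_image_eq_iff[OF r_inj] edge_sub by (meson inj_onI)
  have in_edges: "r ` e \<in> multipartite_edges ns" if "e \<in> multipartite_edges ?ns" for e
    using that r_edges bip_edges_subset[OF kl] by blast
  obtain ctr :: "nat \<Rightarrow> complex" and rad :: "nat \<Rightarrow> real" where
    cr: "\<forall>i<length ns. rad i > 0"
        "\<forall>i<length ns. \<forall>j<length ns. i \<noteq> j \<longrightarrow> sphere (ctr i) (rad i) \<inter> sphere (ctr j) (rad j) = {}"
        "\<forall>i<length ns. \<forall>j<ns ! i. pos (i, j) \<in> sphere (ctr i) (rad i)"
        "\<forall>e\<in>multipartite_edges ns. \<forall>i<length ns. path_interior (\<gamma> e) \<inter> sphere (ctr i) (rad i) = {}"
    using d unfolding partite_circle_drawing_def by blast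
  have dr: "drawing (multipartite_verts ns) (multipartite_edges ns) pos \<gamma>"
    using d unfolding partite_circle_drawing_def by blast
  have "drawing (multipartite_verts ?ns) (multipartite_edges ?ns) (pos \<circ> r) (\<gamma> \<circ> (`) r)"
    unfolding drawing_def
  proof (intro conjI ballI impI)
    show "inj_on (pos \<circ> r) (multipartite_verts ?ns)"
      using dr r_inj r_verts unfolding drawing_def by (metis comp_inj_on inj_on_subset)
    fix e assume e: "e \<in> multipartite_edges ?ns"
    show "arc ((\<gamma> \<circ> (`) r) e)" "{pathstart ((\<gamma> \<circ> (`) r) e), pathfinish ((\<gamma> \<circ> (`) r) e)} = (pos \<circ> r) ` e"
      using dr in_edges[OF e] unfolding drawing_def by (auto simp: image_comp)
    show "path_interior ((\<gamma> \<circ> (`) r) e) \<inter> (pos \<circ> r) ` multipartite_verts ?ns = {}"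
      using dr in_edges[OF e] r_verts unfolding drawing_def by (fastforce simp: image_comp)
    fix f assume f: "f \<in> multipartite_edges ?ns" "e \<noteq> f"
    then have "r ` e \<noteq> r ` f" using e r_inj_edges by (auto simp: inj_on_def)
    then show "finite (path_image ((\<gamma> \<circ> (`) r) e) \<inter> path_image ((\<gamma> \<circ> (`) r) f))"
      using dr in_edges[OF e] in_edges[OF f(1)] unfolding drawing_def by simp
  qed
  moreover have "\<exists>(ctr :: nat \<Rightarrow> complex) (rad :: nat \<Rightarrow> real).
        (\<forall>i<length ?ns. rad i > 0) \<and>
        (\<forall>i<length ?ns. \<forall>j<length ?ns. i \<noteq> j \<longrightarrow>
           sphere (ctr i) (rad i) \<inter> sphere (ctr j) (rad j) = {}) \<and>
        (\<forall>i<length ?ns. \<forall>j<?ns ! i. (pos \<circ> r) (i, j) \<in> sphere (ctr i) (rad i)) \<and>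
        (\<forall>e\<in>multipartite_edges ?ns. \<forall>i<length ?ns.
           path_interior ((\<gamma> \<circ> (`) r) e) \<inter> sphere (ctr i) (rad i) = {})"
    using cr kl in_edges
    by (intro exI[of _ "\<lambda>i. ctr (if i = 0 then k else l)"] exI[of _ "\<lambda>i. rad (if i = 0 then k else l)"])
       (auto simp: r_def less_Suc_eq)
  ultimately have "partite_circle_drawing ?ns (pos \<circ> r) (\<gamma> \<circ> (`) r)"
    unfolding partite_circle_drawing_def by blast
  from partite_circle_cr_le[OF this] show ?thesis
    using cross_between_image[OF r_inj_edges, of \<gamma>] by (simp add: crossings_eq r_edges)
qed

section \<open>Edges of a drawing at one of its circles\<close>

lemma drawingD:
  assumes "drawing V E pos \<gamma>"
  shows "inj_on pos V"
    and "e \<in> E \<Longrightarrow> arc (\<gamma> e)"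
    and "e \<in> E \<Longrightarrow> {pathstart (\<gamma> e), pathfinish (\<gamma> e)} = pos ` e"
    and "e \<in> E \<Longrightarrow> path_interior (\<gamma> e) \<inter> pos ` V = {}"
    and "e \<in> E \<Longrightarrow> f \<in> E \<Longrightarrow> e \<noteq> f \<Longrightarrow> finite (path_image (\<gamma> e) \<inter> path_image (\<gamma> f))"
proof -
  note d = assms[unfolded drawing_def]
  note 2 = bspec[OF conjunct1[OF conjunct2[OF d]]]
  note 3 = mp[OF bspec[OF bspec[OF conjunct2[OF conjunct2[OF d]]]]]
  show "inj_on pos V" by (rule conjunct1[OF d])
  show "arc (\<gamma> e)" if "e \<in> E" by (rule conjunct1[OF 2[OF that]])
  show "{pathstart (\<gamma> e), pathfinish (\<gamma> e)} = pos ` e" if "e \<in> E"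
    by (rule conjunct1[OF conjunct2[OF 2[OF that]]])
  show "path_interior (\<gamma> e) \<inter> pos ` V = {}" if "e \<in> E"
    by (rule conjunct2[OF conjunct2[OF 2[OF that]]])
  show "finite (path_image (\<gamma> e) \<inter> path_image (\<gamma> f))" if "e \<in> E" "f \<in> E" "e \<noteq> f"
    by (rule 3[OF that])
qed

text \<open>Edges are unordered, so \<open>\<gamma>\<close> may trace them either way, whereas a
  star needs its arcs directed away from its centre.\<close>

lemma edge_path_from:
  assumes "drawing V E pos \<gamma>" "{u, v} \<in> E"
  obtains g where "arc g" "pathstart g = pos u" "pathfinish g = pos v"
    "path_image g = path_image (\<gamma> {u, v})" "path_interior g = path_interior (\<gamma> {u, v})"
proof -
  have a: "arc (\<gamma> {u, v})" "{pathstart (\<gamma> {u, v}), pathfinish (\<gamma> {u, v})} = {pos u, pos v}"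
    using drawingD(2,3)[OF assms] by simp_all
  from a(2) consider "pathstart (\<gamma> {u, v}) = pos u" "pathfinish (\<gamma> {u, v}) = pos v"
    | "pathstart (\<gamma> {u, v}) = pos v" "pathfinish (\<gamma> {u, v}) = pos u"
    by (auto simp: doubleton_eq_iff)
  then show ?thesis
  proof cases
    case 1
    then show ?thesis using that[of "\<gamma> {u, v}"] a(1) by simp
  next
    case 2
    then show ?thesis
      using that[of "reversepath (\<gamma> {u, v})"] a(1)
      by (simp add: arc_reversepath path_interior_def insert_commute)
  qed
qed

lemma path_image_eq_interior: "path_image g = path_interior g \<union> {pathstart g, pathfinish g}"
  unfolding path_interior_def by auto

text \<open>The edge joining \<open>(l, i)\<close> and \<open>(m, j)\<close> puts both stars on one
  side of circle \<open>k\<close>. As \<open>a \<noteq> b\<close>, the two intersecting edges have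
  four distinct end vertices, and no edge interior contains a vertex; so the common point is
  interior to both and counts as a crossing.\<close>

lemma stars_cross_on_triple:
  assumes d: "partite_circle_drawing ns pos \<gamma>"
    and klm: "k < length ns" "l < length ns" "m < length ns" "k \<noteq> l" "k \<noteq> m" "l \<noteq> m"
    and u: "i < ns ! l" and v: "j < ns ! m"
    and t: "\<And>a. a < 3 \<Longrightarrow> t a < ns ! k" "inj_on t {..<3::nat}"
  shows "\<exists>a<3. \<exists>b<3. a \<noteq> b \<and> path_interior (\<gamma> {(k, t a), (l, i)}) \<inter> path_interior (\<gamma> {(k, t b), (m, j)}) \<noteq> {}"
proof -
  have dr: "drawing (multipartite_verts ns) (multipartite_edges ns) pos \<gamma>"
    using d unfolding partite_circle_drawing_def by blast
  obtain ctr :: "nat \<Rightarrow> complex" and rad :: "nat \<Rightarrow> real" where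
    cr: "\<forall>i<length ns. rad i > 0"
        "\<forall>i<length ns. \<forall>j<length ns. i \<noteq> j \<longrightarrow> sphere (ctr i) (rad i) \<inter> sphere (ctr j) (rad j) = {}"
        "\<forall>i<length ns. \<forall>j<ns ! i. pos (i, j) \<in> sphere (ctr i) (rad i)"
        "\<forall>e\<in>multipartite_edges ns. \<forall>i<length ns. path_interior (\<gamma> e) \<inter> sphere (ctr i) (rad i) = {}"
    using d unfolding partite_circle_drawing_def by blast
  let ?C = "sphere (ctr k) (rad k)"
  let ?u = "(l, i)" and ?v = "(m, j)"
  have E: "{?u, (k, t a)} \<in> multipartite_edges ns" "{?v, (k, t a)} \<in> multipartite_edges ns" if "a < 3" for a
    using that klm u v t(1)[OF that] by (fastforce simp: multipartite_edges_def multipartite_verts_def)+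
  have Euv: "{?u, ?v} \<in> multipartite_edges ns"
    using klm u v by (fastforce simp: multipartite_edges_def multipartite_verts_def)
  have uvC: "pos ?u \<notin> ?C" "pos ?v \<notin> ?C"
    using cr klm u v by blast+
  obtain e where e: "arc e" "pathstart e = pos ?u" "pathfinish e = pos ?v"
    "path_interior e = path_interior (\<gamma> {?u, ?v})"
    using edge_path_from[OF dr Euv] by metis
  have eC: "path_image e \<inter> ?C = {}"
    using e uvC cr(4) Euv klm(1) unfolding path_image_eq_interior[of e] by auto
  define G where "G = (\<lambda>w a g. arc g \<and> pathstart g = pos w \<and> pathfinish g = pos (k, t a) \<and>
      path_image g = path_image (\<gamma> {w, (k, t a)}) \<and> path_interior g = path_interior (\<gamma> {w, (k, t a)}))"
  define g where "g = (\<lambda>a. SOME f. G ?u a f)"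
  define h where "h = (\<lambda>a. SOME f. G ?v a f)"
  have exG: "\<exists>f. G w a f" if "{w, (k, t a)} \<in> multipartite_edges ns" for w a
    using edge_path_from[OF dr that] unfolding G_def by metis
  have g: "G ?u a (g a)" and h: "G ?v a (h a)" if "a < 3" for a
  proof -
    show "G ?u a (g a)" unfolding g_def
      by (rule someI_ex[OF exG[OF E(1)[OF that]]])
    show "G ?v a (h a)" unfolding h_def
      by (rule someI_ex[OF exG[OF E(2)[OF that]]])
  qed
  have gC: "path_image f \<inter> ?C \<subseteq> {pos (k, t a)}" if "G w a f" "a < 3" "w = ?u \<or> w = ?v" for w a f
    using that E[OF that(2)] cr(4) klm(1) uvC unfolding path_image_eq_interior[of f] G_def by auto
  have "\<exists>a<3. \<exists>b<3. a \<noteq> b \<and> path_image (g a) \<inter> path_image (h b) \<noteq> {}"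
  proof (rule two_stars_at_circle_cross[where x = "\<lambda>a. pos (k, t a)"])
    show "arc (g a) \<and> pathstart (g a) = pos ?u \<and> pathfinish (g a) = pos (k, t a) \<and> path_image (g a) \<inter> ?C \<subseteq> {pos (k, t a)}"
      if "a < 3" for a using g[OF that] gC[OF g[OF that] that] by (simp add: G_def)
    show "arc (h a) \<and> pathstart (h a) = pos ?v \<and> pathfinish (h a) = pos (k, t a) \<and> path_image (h a) \<inter> ?C \<subseteq> {pos (k, t a)}"
      if "a < 3" for a using h[OF that] gC[OF h[OF that] that] by (simp add: G_def)
    show "pos (k, t a) \<in> ?C" if "a < 3" for a using t(1)[OF that] cr(3) klm(1) by blast
  qed (use e eC cr klm in \<open>auto intro: arc_imp_path\<close>)
  then obtain a b z where ab: "a < 3" "b < 3" "a \<noteq> b" "z \<in> path_image (g a)" "z \<in> path_image (h b)"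
    by blast
  have V: "?u \<in> multipartite_verts ns" "?v \<in> multipartite_verts ns"
    "(k, t a) \<in> multipartite_verts ns" "(k, t b) \<in> multipartite_verts ns"
    using klm u v t(1) ab by (auto simp: multipartite_verts_def)
  have "t a \<noteq> t b" using t(2) ab by (auto simp: inj_on_def)
  then have ne: "pos ?u \<noteq> pos ?v" "pos ?u \<noteq> pos (k, t b)" "pos (k, t a) \<noteq> pos ?v" "pos (k, t a) \<noteq> pos (k, t b)"
    using inj_onD[OF drawingD(1)[OF dr]] V klm by blast+
  have av: "path_interior (g a) \<inter> pos ` multipartite_verts ns = {}" "path_interior (h b) \<inter> pos ` multipartite_verts ns = {}"
    using drawingD(4)[OF dr E(1)[OF ab(1)]] drawingD(4)[OF dr E(2)[OF ab(2)]] g[OF ab(1)] h[OF ab(2)]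
    unfolding G_def by simp_all
  have "z \<in> path_interior (g a) \<and> z \<in> path_interior (h b)"
    using ab(4,5) g[OF ab(1)] h[OF ab(2)] av V ne
    unfolding path_image_eq_interior[of "g a"] path_image_eq_interior[of "h b"] G_def by auto
  then have "z \<in> path_interior (\<gamma> {(k, t a), (l, i)}) \<inter> path_interior (\<gamma> {(k, t b), (m, j)})"
    using g[OF ab(1)] h[OF ab(2)] by (simp add: G_def insert_commute)
  then show ?thesis using ab by blast
qed

text \<open>Mantel's bound holds for each choice of a vertex on circle \<open>l\<close> and one on
  circle \<open>m\<close>; one crossing is selected for every pair it provides, and all the selected
  crossings are distinct.\<close>

lemma card_cross_between_ge:
  assumes d: "partite_circle_drawing ns pos \<gamma>"
    and klm: "k < length ns" "l < length ns" "m < length ns" "k \<noteq> l" "k \<noteq> m" "l \<noteq> m"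
    and fin: "finite (cross_between (bip_edges ns k l) (bip_edges ns k m) \<gamma>)"
  shows "ns ! l * ns ! m * (((ns ! k - 1) div 2) * (ns ! k div 2))
           \<le> card (cross_between (bip_edges ns k l) (bip_edges ns k m) \<gamma>)"
proof -
  define Q where "Q = (\<lambda>i j x y. path_interior (\<gamma> {(k, x), (l, i)}) \<inter> path_interior (\<gamma> {(k, y), (m, j)}) \<noteq> {})"
  \<comment> \<open>Mantel needs a symmetric relation, while \<open>Q\<close> distinguishes the two
    stars.\<close>
  define P where "P = (\<lambda>i j x y. Q i j x y \<or> Q i j y x)"
  define V where "V = {..<ns ! k}"
  define H where "H = (\<lambda>i j. {{x, y} | x y. x \<in> V \<and> y \<in> V \<and> x \<noteq> y \<and> P i j x y})"
  let ?Y = "cross_between (bip_edges ns k l) (bip_edges ns k m) \<gamma>"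
  let ?Z = "((ns ! k - 1) div 2) * (ns ! k div 2)"
  have finH: "finite (H i j)" for i j
    by (rule finite_subset[of _ "Pow V"]) (auto simp: H_def V_def)
  have H: "?Z \<le> card (H i j)" if ij: "i < ns ! l" "j < ns ! m" for i j
  proof -
    have "P i j x y \<or> P i j y z \<or> P i j x z"
      if "x \<in> V" "y \<in> V" "z \<in> V" "x \<noteq> y" "y \<noteq> z" "x \<noteq> z" for x y z
    proof -
      define t where "t = (\<lambda>a::nat. if a = 0 then x else if a = 1 then y else z)"
      have t: "t a < ns ! k" for a using that by (simp add: t_def V_def)
      have "inj_on t {..<3}" using that by (auto simp: inj_on_def t_def split: if_splits)
      from stars_cross_on_triple[OF d klm ij t this]
      obtain a b where ab: "a < 3" "b < 3" "a \<noteq> b" "Q i j (t a) (t b)"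
        unfolding Q_def by blast
      then have "a = 0 \<or> a = 1 \<or> a = 2" "b = 0 \<or> b = 1 \<or> b = 2" by auto
      then show ?thesis using ab(3,4) unfolding P_def
        by (elim disjE) (simp_all add: t_def)
    qed
    then show ?thesis
      using mantel_complement[of V "P i j"] unfolding H_def V_def P_def
      by (metis (no_types, lifting) card_lessThan finite_lessThan)
  qed
  define S where "S = (\<lambda>(i, j, p). {({{(k, x), (l, i)}, {(k, y), (m, j)}}, z) | x y z.
      p = {x, y} \<and> x \<in> V \<and> y \<in> V \<and> x \<noteq> y \<and>
      z \<in> path_interior (\<gamma> {(k, x), (l, i)}) \<inter> path_interior (\<gamma> {(k, y), (m, j)})})"
  define I where "I = (SIGMA i:{..<ns ! l}. SIGMA j:{..<ns ! m}. H i j)"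
  have Sne: "S q \<noteq> {}" if "q \<in> I" for q
  proof -
    obtain i j x y where q: "q = (i, j, {x, y})" "x \<in> V" "y \<in> V" "x \<noteq> y" "P i j x y"
      using \<open>q \<in> I\<close> unfolding I_def H_def by auto
    then consider "Q i j x y" | "Q i j y x" by (auto simp: P_def)
    then show ?thesis
    proof cases
      case 1
      then obtain z where "z \<in> path_interior (\<gamma> {(k, x), (l, i)}) \<inter> path_interior (\<gamma> {(k, y), (m, j)})"
        unfolding Q_def by blast
      then show ?thesis using q(2-4) unfolding q(1) S_def by blast
    next
      case 2
      then obtain z where "z \<in> path_interior (\<gamma> {(k, y), (l, i)}) \<inter> path_interior (\<gamma> {(k, x), (m, j)})"
        unfolding Q_def by blast
      moreover have "{x, y} = {y, x}" by blast
      ultimately show ?thesis using q(2-4) unfolding q(1) S_def by blast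
    qed
  qed
  define c where "c = (\<lambda>q. SOME s. s \<in> S q)"
  have cS: "c q \<in> S q" if "q \<in> I" for q
    using Sne[OF that] unfolding c_def by (simp add: some_in_eq)
  have "inj_on c I"
  proof (rule inj_onI)
    fix q q' assume q: "q \<in> I" "q' \<in> I" "c q = c q'"
    obtain i j P where ij: "q = (i, j, P)" by (cases q)
    obtain i' j' P' where ij': "q' = (i', j', P')" by (cases q')
    from cS[OF q(1)] obtain x y z where 1: "c q = ({{(k, x), (l, i)}, {(k, y), (m, j)}}, z)" "P = {x, y}"
      unfolding ij S_def by auto
    from cS[OF q(2)] obtain x' y' z' where 2: "c q' = ({{(k, x'), (l, i')}, {(k, y'), (m, j')}}, z')" "P' = {x', y'}"
      unfolding ij' S_def by auto
    have "{{(k, x), (l, i)}, {(k, y), (m, j)}} = {{(k, x'), (l, i')}, {(k, y'), (m, j')}}"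
      using q(3) 1(1) 2(1) by simp
    \<comment> \<open>An edge to part \<open>l\<close> is not one to part \<open>m\<close>, so equal
      edge pairs cannot match crosswise and the index can be read off from the crossing.\<close>
    moreover have "{(k, x), (l, i)} \<noteq> {(k, y'), (m, j')}"
      using klm by (simp add: doubleton_eq_iff)
    ultimately have "{(k, x), (l, i)} = {(k, x'), (l, i')}" "{(k, y), (m, j)} = {(k, y'), (m, j')}"
      by (rule doubleton_eqD)+
    then have "x = x'" "i = i'" "y = y'" "j = j'"
      using klm by (simp_all add: doubleton_eq_iff)
    then show "q = q'" using ij ij' 1(2) 2(2) by simp
  qed
  moreover have "c ` I \<subseteq> ?Y"
  proof -
    have "S q \<subseteq> ?Y" if q: "q \<in> I" for q
    proof
      fix s assume s: "s \<in> S q"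
      obtain i j p where ij: "q = (i, j, p)" "i < ns ! l" "j < ns ! m" using q by (auto simp: I_def)
      obtain x y z where xyz: "s = ({{(k, x), (l, i)}, {(k, y), (m, j)}}, z)" "x \<in> V" "y \<in> V"
        "z \<in> path_interior (\<gamma> {(k, x), (l, i)}) \<inter> path_interior (\<gamma> {(k, y), (m, j)})"
        using s unfolding ij(1) S_def prod.case by blast
      have "{(k, x), (l, i)} \<in> bip_edges ns k l" "{(k, y), (m, j)} \<in> bip_edges ns k m"
        using xyz ij by (auto simp: bip_edges_def V_def)
      moreover have "{(k, x), (l, i)} \<noteq> {(k, y), (m, j)}"
        using klm by (auto simp: doubleton_eq_iff)
      ultimately show "s \<in> ?Y" using xyz(4) unfolding xyz(1) by (intro cross_betweenI) simp_all
    qed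
    then show ?thesis using cS by blast
  qed
  ultimately have "card I \<le> card ?Y" using fin card_inj_on_le by blast
  moreover have "card I = (\<Sum>i<ns ! l. \<Sum>j<ns ! m. card (H i j))"
    unfolding I_def using finH by (simp add: card_SigmaI)
  moreover have "(\<Sum>i<ns ! l. \<Sum>j<ns ! m. ?Z) \<le> (\<Sum>i<ns ! l. \<Sum>j<ns ! m. card (H i j))"
    using H by (intro sum_mono) auto
  ultimately show ?thesis by (simp add: algebra_simps)
qed

subsection \<open>The lower bound\<close>

lemma sum_card_fibres_le:
  assumes "finite X" "finite T" "\<And>t. t \<in> T \<Longrightarrow> S t \<subseteq> {x \<in> X. f x = t}"
  shows "(\<Sum>t\<in>T. card (S t)) \<le> card X"
proof -
  have "finite (S t)" if "t \<in> T" for t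
    using assms(1) assms(3)[OF that] by (rule_tac finite_subset[of _ X]) auto
  then have "(\<Sum>t\<in>T. card (S t)) = card (\<Union>t\<in>T. S t)"
    using assms(2,3) by (intro card_UN_disjoint[symmetric] ballI impI) blast+
  also have "\<dots> \<le> card X"
    using assms(1,3) by (intro card_mono) auto
  finally show ?thesis .
qed

text \<open>\<open>image fst\<close> turns an edge into the set of the two parts it joins. This
  label keeps the six classes of crossings disjoint.\<close>

lemma cross_between_bip_type:
  assumes "s \<in> cross_between (bip_edges ns k l) (bip_edges ns k' l') \<gamma>"
  shows "image fst ` fst s = {{k, l}, {k', l'}}"
  using assms
proof (rule cross_betweenE)
  fix e f x assume "s = ({e, f}, x)" "e \<in> bip_edges ns k l" "f \<in> bip_edges ns k' l'"
  then show ?thesis by (auto simp: bip_edges_image)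
qed

lemma tripartite_crossings_ge:
  assumes d: "partite_circle_drawing [m, n, p] pos \<gamma>"
  shows "(\<Sum>(a, b, c) \<leftarrow> [(m, n, p), (n, p, m), (p, m, n)].
             partite_circle_cr [a, b] + enat (a * b * ((c - 1) div 2) * (c div 2)))
           \<le> enat (crossings (multipartite_edges [m, n, p]) \<gamma>)"
proof -
  let ?ns = "[m, n, p]"
  define B where "B = bip_edges ?ns"
  define C where "C = (\<lambda>k l k' l'. cross_between (B k l) (B k' l') \<gamma>)"
  define X where "X = cross_between (multipartite_edges ?ns) (multipartite_edges ?ns) \<gamma>"
  have dr: "drawing (multipartite_verts ?ns) (multipartite_edges ?ns) pos \<gamma>"
    using d unfolding partite_circle_drawing_def by (rule conjunct1)
  have finX: "finite X"
    unfolding X_def by (rule finite_cross_between[OF finite_multipartite_edges drawingD(5)[OF dr]])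
  have CX: "C k l k' l' \<subseteq> X" if "k < 3" "l < 3" "k \<noteq> l" "k' < 3" "l' < 3" "k' \<noteq> l'" for k l k' l'
    unfolding C_def X_def B_def using that by (intro cross_between_mono bip_edges_subset) auto
  \<comment> \<open>Three edge types give six unordered pairs of types: 0 to 2 for equal types, 3 to
    5 for types sharing circle 2, 0 and 1 respectively.\<close>
  define S where "S = (\<lambda>t::nat. if t = 0 then C 0 1 0 1 else if t = 1 then C 1 2 1 2 else if t = 2 then C 2 0 2 0
     else if t = 3 then C 2 0 2 1 else if t = 4 then C 0 1 0 2 else C 1 2 1 0)"
  define \<tau> where "\<tau> = (\<lambda>y::nat set set. if y = {{0,1}} then 0 else if y = {{1,2}} then 1 else if y = {{2,0}} then 2
     else if y = {{2,0},{2,1}} then 3 else if y = {{0,1},{0,2}} then 4 else (5::nat))"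
  have \<tau>: "\<tau> {{0,1},{0,1}} = 0" "\<tau> {{1,2},{1,2}} = 1" "\<tau> {{2,0},{2,0}} = 2"
    "\<tau> {{2,0},{2,1}} = 3" "\<tau> {{0,1},{0,2}} = 4" "\<tau> {{1,2},{1,0}} = 5"
    by (simp_all add: \<tau>_def doubleton_eq_iff)
  have tau_C: "\<tau> (image fst ` fst s) = \<tau> {{k, l}, {k', l'}}" if "s \<in> C k l k' l'" for s k l k' l'
    using cross_between_bip_type that unfolding C_def B_def by metis
  have "(\<Sum>t\<in>{0,1,2,3,4,5}. card (S t)) \<le> card X"
  proof (rule sum_card_fibres_le[OF finX, where f = "\<lambda>s. \<tau> (image fst ` fst s)"])
    fix t :: nat assume "t \<in> {0,1,2,3,4,5}"
    then show "S t \<subseteq> {s \<in> X. \<tau> (image fst ` fst s) = t}"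
    proof (elim insertE)
      assume "t = 0" then have "S t = C 0 1 0 1" by (simp add: S_def)
      then show ?thesis using CX[of 0 1 0 1] tau_C[of _ 0 1 0 1] \<tau>(1) \<open>t = 0\<close> by auto
    next
      assume "t = 1" then have "S t = C 1 2 1 2" by (simp add: S_def)
      then show ?thesis using CX[of 1 2 1 2] tau_C[of _ 1 2 1 2] \<tau>(2) \<open>t = 1\<close> by auto
    next
      assume "t = 2" then have "S t = C 2 0 2 0" by (simp add: S_def)
      then show ?thesis using CX[of 2 0 2 0] tau_C[of _ 2 0 2 0] \<tau>(3) \<open>t = 2\<close> by auto
    next
      assume "t = 3" then have "S t = C 2 0 2 1" by (simp add: S_def)
      then show ?thesis using CX[of 2 0 2 1] tau_C[of _ 2 0 2 1] \<tau>(4) \<open>t = 3\<close> by auto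
    next
      assume "t = 4" then have "S t = C 0 1 0 2" by (simp add: S_def)
      then show ?thesis using CX[of 0 1 0 2] tau_C[of _ 0 1 0 2] \<tau>(5) \<open>t = 4\<close> by auto
    next
      assume "t = 5" then have "S t = C 1 2 1 0" by (simp add: S_def)
      then show ?thesis using CX[of 1 2 1 0] tau_C[of _ 1 2 1 0] \<tau>(6) \<open>t = 5\<close> by auto
    qed simp
  qed simp
  then have total: "card (C 0 1 0 1) + card (C 1 2 1 2) + card (C 2 0 2 0)
      + card (C 2 0 2 1) + card (C 0 1 0 2) + card (C 1 2 1 0) \<le> crossings (multipartite_edges ?ns) \<gamma>"
    by (simp add: S_def crossings_eq X_def)
  have same: "partite_circle_cr [?ns ! k, ?ns ! l] \<le> enat (card (C k l k l))" if "k < 3" "l < 3" "k \<noteq> l" for k l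
    using partite_circle_cr_bipartite_le[OF d, of k l] that by (simp add: C_def B_def crossings_eq)
  have mixed: "?ns ! l * ?ns ! q * (((?ns ! k - 1) div 2) * (?ns ! k div 2)) \<le> card (C k l k q)"
    if "k < 3" "l < 3" "q < 3" "k \<noteq> l" "k \<noteq> q" "l \<noteq> q" for k l q
  proof -
    have "finite (C k l k q)"
      by (rule finite_subset[OF CX finX]) (use that in auto)
    then show ?thesis
      using card_cross_between_ge[OF d, of k l q] that by (simp add: C_def B_def)
  qed
  have "partite_circle_cr [m, n] + enat (m * n * ((p - 1) div 2) * (p div 2)) \<le> enat (card (C 0 1 0 1) + card (C 2 0 2 1))"
    using same[of 0 1] mixed[of 2 0 1] unfolding plus_enat_simps(1)[symmetric]
    by (intro add_mono) (simp_all add: mult.assoc)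
  moreover have "partite_circle_cr [n, p] + enat (n * p * ((m - 1) div 2) * (m div 2)) \<le> enat (card (C 1 2 1 2) + card (C 0 1 0 2))"
    using same[of 1 2] mixed[of 0 1 2] unfolding plus_enat_simps(1)[symmetric]
    by (intro add_mono) (simp_all add: mult.assoc)
  moreover have "partite_circle_cr [p, m] + enat (p * m * ((n - 1) div 2) * (n div 2)) \<le> enat (card (C 2 0 2 0) + card (C 1 2 1 0))"
    using same[of 2 0] mixed[of 1 2 0] unfolding plus_enat_simps(1)[symmetric]
    by (intro add_mono) (simp_all add: mult.assoc)
  ultimately have "(partite_circle_cr [m, n] + enat (m * n * ((p - 1) div 2) * (p div 2)))
    + ((partite_circle_cr [n, p] + enat (n * p * ((m - 1) div 2) * (m div 2)))
    + (partite_circle_cr [p, m] + enat (p * m * ((n - 1) div 2) * (n div 2))))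
    \<le> enat (card (C 0 1 0 1) + card (C 2 0 2 1)) + (enat (card (C 1 2 1 2) + card (C 0 1 0 2)) + enat (card (C 2 0 2 0) + card (C 1 2 1 0)))"
    by (intro add_mono)
  also have "\<dots> \<le> enat (crossings (multipartite_edges ?ns) \<gamma>)"
    using total by simp
  finally show ?thesis by simp
qed

subsection \<open>Three circles in three cells\<close>

text \<open>
  \<open>cell k\<close> gives coordinates for the region of circle \<open>k\<close>, which has centre
  \<open>cis (2 * pi * k / 3) * cell0_center\<close> and radius \<open>1/2\<close>: \<open>s = 0\<close> is the circle, and for \<open>s = 1\<close> the
  distance \<open>rho t\<close> from the centre is cut off by the two bisectors (at distance 1) and capped at 2
  elsewhere.  Angles \<open>t\<close> are in units of 60 degrees, hence have period 6, and are measured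
  from the direction of circle \<open>k + 1\<close>; circle \<open>k - 1\<close> is at \<open>t = 1\<close>.
\<close>

definition rho :: "real \<Rightarrow> real" where
  "rho t = 1 / max (1/2) (max (cos (pi * t / 3)) (cos (pi * (t - 1) / 3)))"

definition radius :: "real \<Rightarrow> real \<Rightarrow> real" where
  "radius s t = (1 - s) / 2 + s * rho t"

text \<open>The centres form an equilateral triangle with side 2 and centroid 0. Centre 1 is
  \<open>Complex 1 (- 1 / sqrt 3)\<close>, so the bisector between cells 0 and 1 is the imaginary
  axis.\<close>

definition cell0_center :: complex where
  "cell0_center = Complex (- 1) (- 1 / sqrt 3)"

definition cell :: "nat \<Rightarrow> real \<Rightarrow> real \<Rightarrow> complex" where
  "cell k s t = cis (2 * pi * k / 3) * (cell0_center + of_real (radius s t) * cis (pi * t / 3))"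

text \<open>Each product is the component of a cell boundary point in the direction of a
  neighbouring circle; at most 1 means that the bisector is not passed.\<close>

lemma rho_bounds: "1 \<le> rho t" "rho t * cos (pi * t / 3) \<le> 1" "rho t * cos (pi * (t - 1) / 3) \<le> 1"
proof -
  let ?M = "max (1/2) (max (cos (pi * t / 3)) (cos (pi * (t - 1) / 3)))"
  have M: "?M \<le> 1" "1/2 \<le> ?M" "cos (pi * t / 3) \<le> ?M" "cos (pi * (t - 1) / 3) \<le> ?M"
    by auto
  then have "?M > 0" by linarith
  then show "1 \<le> rho t" "rho t * cos (pi * t / 3) \<le> 1" "rho t * cos (pi * (t - 1) / 3) \<le> 1"
    using M unfolding rho_def by (simp_all add: divide_simps del: max.bounded_iff le_max_iff_disj)
qed

lemma continuous_on_rho: "continuous_on A rho"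
proof -
  have "max (1/2) x \<noteq> 0" for x :: real by (simp add: max_def)
  then show ?thesis unfolding rho_def
    by (intro continuous_on_divide continuous_on_max continuous_intros ballI) simp_all
qed

section \<open>Periodicity and injectivity of the cell coordinates\<close>

lemma cos_sin_period_6:
  "cos (pi * (t + 6 * of_int j) / 3) = cos (pi * t / 3)"
  "sin (pi * (t + 6 * of_int j) / 3) = sin (pi * t / 3)"
proof -
  have e: "pi * (t + 6 * of_int j) / 3 = pi * t / 3 + 2 * pi * of_int j"
    by (simp add: field_simps)
  have p: "sin (x + 2 * pi * of_int j) = sin x" "cos (x + 2 * pi * of_int j) = cos x" for x :: real
    using sin_cos_eq_iff[of "x + 2 * pi * of_int j" x] by auto
  show "cos (pi * (t + 6 * of_int j) / 3) = cos (pi * t / 3)"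
    "sin (pi * (t + 6 * of_int j) / 3) = sin (pi * t / 3)"
    unfolding e by (rule p)+
qed

lemma rho_period: "rho (t + 6 * of_int j) = rho t"
proof -
  have "t + 6 * of_int j - 1 = (t - 1) + 6 * of_int j" by simp
  then show ?thesis unfolding rho_def by (simp only: cos_sin_period_6)
qed

lemma cell_period: "cell k s (t + 6 * of_int j) = cell k s t"
proof -
  have "cis (pi * (t + 6 * of_int j) / 3) = cis (pi * t / 3)"
    by (simp only: complex_eq_iff cis.simps cos_sin_period_6 simp_thms)
  then show ?thesis by (simp only: cell_def radius_def rho_period)
qed

lemma cell_period_3: "cell (k + 3) s t = cell k s t"
proof -
  have "2 * pi * real (k + 3) / 3 = 2 * pi * k / 3 + 2 * pi" by (simp add: field_simps)
  then have "cis (2 * pi * real (k + 3) / 3) = cis (2 * pi * k / 3)"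
    by (simp only: cis_mult[symmetric] cis_2pi mult_1_right)
  then show ?thesis by (simp add: cell_def)
qed

lemma radius_ge: "0 \<le> s \<Longrightarrow> radius s t \<ge> 1/2 + s / 2"
proof -
  assume "0 \<le> s"
  then have "s * 1 \<le> s * rho t" using rho_bounds(1)[of t] by (intro mult_left_mono) auto
  then show ?thesis by (simp add: radius_def field_simps)
qed

text \<open>In polar coordinates about the centre, equal points have equal radii and angles equal
  modulo 6, hence equal \<open>rho\<close>. For a fixed angle the radius increases strictly with
  \<open>s\<close> because \<open>rho t > 1/2\<close>.\<close>

lemma cell_inj:
  assumes "cell k s t = cell k s' t'" "0 \<le> s" "0 \<le> s'"
  shows "s = s' \<and> (\<exists>j::int. t = t' + 6 * of_int j)"
proof -
  have eq: "of_real (radius s t) * cis (pi * t / 3) = of_real (radius s' t') * cis (pi * t' / 3)"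
    using assms(1) by (simp add: cell_def)
  have pos: "radius s t > 0" "radius s' t' > 0"
    using radius_ge[of s t] radius_ge[of s' t'] assms(2,3) by linarith+
  have "norm (of_real (radius s t) * cis (pi * t / 3)) = norm (of_real (radius s' t') * cis (pi * t' / 3))"
    using eq by simp
  then have R: "radius s t = radius s' t'"
    using pos by (simp add: norm_mult)
  then have "cis (pi * t / 3) = cis (pi * t' / 3)" using eq pos by simp
  then have "sin (pi * t / 3) = sin (pi * t' / 3) \<and> cos (pi * t / 3) = cos (pi * t' / 3)"
    by (simp add: complex_eq_iff)
  then obtain j :: int where "pi * t / 3 = pi * t' / 3 + 2 * pi * of_int j"
    unfolding sin_cos_eq_iff by blast
  then have "pi * t = pi * (t' + 6 * of_int j)" by (simp add: field_simps)
  then have t: "t = t' + 6 * of_int j" by simp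
  then have "rho t = rho t'" by (simp add: rho_period)
  then have "(s - s') * (rho t - 1 / 2) = 0"
    using R by (simp add: radius_def field_simps)
  moreover have "rho t - 1 / 2 \<noteq> 0" using rho_bounds(1)[of t] by linarith
  ultimately show ?thesis using t by auto
qed

lemma cell_inj_lt:
  assumes "cell k s t = cell k s' t'" "0 \<le> s" "0 \<le> s'" "\<bar>t - t'\<bar> < 6"
  shows "s = s'" "t = t'"
proof -
  obtain j :: int where j: "s = s'" "t = t' + 6 * of_int j" using cell_inj[OF assms(1-3)] by blast
  then have "\<bar>real_of_int j\<bar> < 1" using assms(4) by simp
  then have "j = 0" by linarith
  then show "s = s'" "t = t'" using j by auto
qed

section \<open>Neighbouring cells and their common bisector\<close>

lemma sqrt_3_facts: "sqrt 3 * sqrt 3 = (3::real)" "sqrt 3 \<noteq> (0::real)"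
  by simp_all

lemma cis_120: "cis (2 * pi / 3) = Complex (- 1 / 2) (sqrt 3 / 2)"
  by (simp only: complex_eq_iff cis.simps complex.sel cos_120 sin_120 simp_thms)

lemma cell_Suc_0: "cell (Suc k) s t = cis (2 * pi * k / 3) * cell 1 s t"
proof -
  have "2 * pi * real (Suc k) / 3 = 2 * pi * k / 3 + 2 * pi / 3" by (simp add: field_simps)
  then have "cis (2 * pi * real (Suc k) / 3) = cis (2 * pi * k / 3) * cis (2 * pi / 3)"
    by (simp only: cis_mult)
  then show ?thesis by (simp add: cell_def mult.assoc)
qed

lemma cell_eq_0: "cell k s t = cis (2 * pi * k / 3) * cell 0 s t"
  by (simp add: cell_def)

text \<open>Measured from the direction \<open>t = 1\<close> of circle 0, cell 1 is visibly the
  mirror image of cell 0 in the imaginary axis, with \<open>t\<close> replaced by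
  \<open>1 - t\<close>.\<close>

lemma cell_1_eq:
  "cell 1 s t = Complex (1 - radius s t * cos (pi * (t - 1) / 3)) (- 1 / sqrt 3 - radius s t * sin (pi * (t - 1) / 3))"
proof -
  have c: "cis (2 * pi / 3) * cell0_center = Complex 1 (- 1 / sqrt 3)"
    unfolding cis_120 cell0_center_def by (simp add: complex_eq_iff field_simps sqrt_3_facts)
  have "2 * pi / 3 + pi * t / 3 = pi * (t - 1) / 3 + pi" by (simp add: field_simps)
  then have "cis (2 * pi / 3) * cis (pi * t / 3) = - cis (pi * (t - 1) / 3)"
    unfolding cis_mult by (simp add: cis_mult[symmetric])
  then have "cell 1 s t = Complex 1 (- 1 / sqrt 3) - of_real (radius s t) * cis (pi * (t - 1) / 3)"
    using c unfolding cell_def by (simp add: distrib_left mult.left_commute)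
  then show ?thesis by (simp add: complex_eq_iff)
qed

text \<open>The summand from the circle contributes at most \<open>(1 - s) / 2\<close>, which leaves
  a slack of \<open>(1 - s) / 2\<close>; so a bisector is reached only at
  \<open>s = 1\<close>.\<close>

lemma radius_mult_le:
  assumes "0 \<le> s" "s \<le> 1" "c \<le> 1" "rho t * c \<le> 1"
  shows "radius s t * c \<le> 1" "radius s t * c = 1 \<Longrightarrow> s = 1"
proof -
  have 1: "s * (rho t * c) \<le> s * 1" using assms by (intro mult_left_mono) auto
  have 0: "(1 - s) / 2 * c \<le> (1 - s) / 2 * 1" using assms by (intro mult_left_mono) auto
  have "radius s t * c = (1 - s) / 2 * c + s * (rho t * c)"
    by (simp add: radius_def distrib_right)
  also have "\<dots> \<le> (1 - s) / 2 * 1 + s * 1"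
    using 0 1 by (rule add_mono)
  also have "\<dots> = 1 - (1 - s) / 2" by (simp add: field_simps)
  finally have 2: "radius s t * c \<le> 1 - (1 - s) / 2" .
  moreover have "1 - (1 - s) / 2 \<le> 1" using assms(2) by simp
  ultimately show "radius s t * c \<le> 1" by (rule order_trans)
  show "s = 1" if "radius s t * c = 1"
  proof -
    have "1 \<le> 1 - (1 - s) / 2" using 2 that by simp
    then show ?thesis using assms(2) by simp
  qed
qed

text \<open>After a rotation these are cells 0 and 1, on opposite sides of the imaginary
  axis.\<close>

lemma cell_Suc_disjoint:
  assumes "cell k s t = cell (Suc k) s' t'" "0 \<le> s" "s \<le> 1" "0 \<le> s'" "s' \<le> 1"
  shows "s = 1" "s' = 1"
proof -
  have "cis (2 * pi * k / 3) * cell 0 s t = cell k s t"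
    by (rule cell_eq_0[symmetric])
  also note assms(1)
  also have "cell (Suc k) s' t' = cis (2 * pi * k / 3) * cell 1 s' t'"
    by (rule cell_Suc_0)
  finally have "cell 0 s t = cell 1 s' t'"
    by (simp only: mult_cancel_left cis_neq_zero simp_thms)
  moreover have "Re (cell 0 s t) = - 1 + radius s t * cos (pi * t / 3)"
    by (simp add: cell_def cell0_center_def)
  moreover have "Re (cell 1 s' t') = 1 - radius s' t' * cos (pi * (t' - 1) / 3)"
    by (simp only: cell_1_eq complex.sel)
  ultimately have e: "- 1 + radius s t * cos (pi * t / 3) = 1 - radius s' t' * cos (pi * (t' - 1) / 3)"
    by (simp only:)
  have 1: "radius s t * cos (pi * t / 3) \<le> 1" "radius s t * cos (pi * t / 3) = 1 \<Longrightarrow> s = 1"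
    using radius_mult_le[OF assms(2,3) cos_le_one rho_bounds(2)] by blast+
  have 2: "radius s' t' * cos (pi * (t' - 1) / 3) \<le> 1" "radius s' t' * cos (pi * (t' - 1) / 3) = 1 \<Longrightarrow> s' = 1"
    using radius_mult_le[OF assms(4,5) cos_le_one rho_bounds(3)] by blast+
  have "radius s t * cos (pi * t / 3) = 1" using e 1(1) 2(1) by linarith
  then show "s = 1" by (rule 1(2))
  have "radius s' t' * cos (pi * (t' - 1) / 3) = 1" using e 1(1) 2(1) by linarith
  then show "s' = 1" by (rule 2(2))
qed

lemma rho_reflect: "rho (1 - t) = rho t"
proof -
  have "pi * (1 - t) / 3 = - (pi * (t - 1) / 3)" "pi * (1 - t - 1) / 3 = - (pi * t / 3)"
    by (simp_all add: field_simps)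
  then have "cos (pi * (1 - t) / 3) = cos (pi * (t - 1) / 3)" "cos (pi * (1 - t - 1) / 3) = cos (pi * t / 3)"
    by (simp_all only: cos_minus)
  then show ?thesis by (simp only: rho_def max.commute)
qed

text \<open>Within 30 degrees of the direction of circle \<open>k + 1\<close> the cosine towards it
  is the largest entry of the maximum, so the cell boundary there is the bisector itself.\<close>

lemma rho_port:
  assumes "\<bar>t\<bar> \<le> 1/2"
  shows "rho t = 1 / cos (pi * t / 3)" "cos (pi * t / 3) > 0"
proof -
  have a: "\<bar>pi * t / 3\<bar> \<le> pi / 6"
    using assms by (simp add: abs_mult field_simps)
  have b: "\<bar>pi * t / 3\<bar> \<le> \<bar>pi * (t - 1) / 3\<bar>" "\<bar>pi * (t - 1) / 3\<bar> \<le> pi"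
    using assms by (simp_all add: abs_mult abs_le_iff)
  have cos_abs: "cos \<bar>x\<bar> = cos x" for x :: real by (simp add: abs_if)
  have "cos \<bar>pi * (t - 1) / 3\<bar> \<le> cos \<bar>pi * t / 3\<bar>"
    using a b by (intro cos_monotone_0_pi_le) auto
  moreover have "cos (pi / 3) \<le> cos \<bar>pi * t / 3\<bar>"
    using a pi_gt_zero by (intro cos_monotone_0_pi_le) linarith+
  ultimately have "cos (pi * (t - 1) / 3) \<le> cos (pi * t / 3)" "1/2 \<le> cos (pi * t / 3)"
    by (simp_all only: cos_abs cos_60)
  then show "rho t = 1 / cos (pi * t / 3)" "cos (pi * t / 3) > 0"
    by (simp_all add: rho_def max_def)
qed

text \<open>One point of the bisector seen from its two sides: the reflection exchanging the cells
  fixes it and turns \<open>t\<close> into \<open>1 - t\<close>.\<close>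

lemma cell_port:
  assumes "\<bar>t\<bar> \<le> 1/2"
  shows "cell k 1 t = cell (Suc k) 1 (1 - t)"
proof -
  have r: "radius 1 t = 1 / cos (pi * t / 3)" "radius 1 (1 - t) = 1 / cos (pi * t / 3)"
    using rho_port[OF assms] by (simp_all add: radius_def rho_reflect)
  have "cell 0 1 t = cell 1 1 (1 - t)"
    unfolding cell_1_eq r using rho_port(2)[OF assms]
    by (simp add: cell_def cell0_center_def r complex_eq_iff)
  then show ?thesis unfolding cell_Suc_0 cell_eq_0[of k] by simp
qed

lemma sphere_eq_cell:
  "sphere (cis (2 * pi * k / 3) * cell0_center) (1/2) = range (cell k 0)"
proof
  show "range (cell k 0) \<subseteq> sphere (cis (2 * pi * k / 3) * cell0_center) (1/2)"
    by (auto simp: cell_def radius_def dist_norm distrib_left norm_mult)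
  show "sphere (cis (2 * pi * k / 3) * cell0_center) (1/2) \<subseteq> range (cell k 0)"
  proof
    fix z assume "z \<in> sphere (cis (2 * pi * k / 3) * cell0_center) (1/2)"
    then have n: "norm (z - cis (2 * pi * k / 3) * cell0_center) = 1/2"
      by (simp add: dist_norm norm_minus_commute)
    define w where "w = (z - cis (2 * pi * k / 3) * cell0_center) * cis (- (2 * pi * k / 3))"
    have z: "z = cis (2 * pi * k / 3) * (cell0_center + w)"
      unfolding w_def by (simp add: distrib_left mult.left_commute[of "cis (2 * pi * k / 3)"] cis_mult)
    have nw: "norm w = 1/2" using n by (simp only: w_def norm_mult norm_cis mult_1_right)
    have "w = of_real (norm w) * cis (Arg w)"
      by (simp only: rcis_def[symmetric] rcis_cmod_Arg)
    then have w: "w = of_real (1/2) * cis (Arg w)" by (simp only: nw)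
    have a: "pi * (3 * Arg w / pi) / 3 = Arg w" by simp
    have r: "radius 0 (3 * Arg w / pi) = 1/2" by (simp add: radius_def)
    have "cell k 0 (3 * Arg w / pi) = cis (2 * pi * k / 3) * (cell0_center + of_real (1/2) * cis (Arg w))"
      unfolding cell_def by (simp only: a r)
    then have "z = cell k 0 (3 * Arg w / pi)"
      by (simp only: z w[symmetric])
    then show "z \<in> range (cell k 0)" by blast
  qed
qed

text \<open>The parameter is the coordinate \<open>s\<close> itself, so two strands in one cell meet
  only at equal parameters, where two affine functions of \<open>s\<close> agree modulo 6.\<close>

definition strand :: "nat \<Rightarrow> real \<Rightarrow> real \<Rightarrow> real \<Rightarrow> complex" where
  "strand k a b s = cell k s ((1 - s) * a + s * b)"

lemma arc_strand: "arc (strand k a b)"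
  unfolding arc_def path_def
proof
  show "continuous_on {0..1} (strand k a b)"
    unfolding strand_def cell_def radius_def cis_conv_exp
    by (intro continuous_intros continuous_on_compose2[OF continuous_on_rho[of UNIV]]) auto
  show "inj_on (strand k a b) {0..1}"
    using cell_inj by (fastforce simp: inj_on_def strand_def)
qed

lemma strand_ends: "pathstart (strand k a b) = cell k 0 a" "pathfinish (strand k a b) = cell k 1 b"
  by (simp_all add: strand_def pathstart_def pathfinish_def)

lemma cell_neq_disjoint:
  assumes "cell k s t = cell l s' t'" "k \<noteq> l" "k < 3" "l < 3" "0 \<le> s" "s \<le> 1" "0 \<le> s'" "s' \<le> 1"
  shows "s = 1" "s' = 1"
proof -
  have "l = Suc k \<or> k = Suc l \<or> k = 2 \<and> l = 0 \<or> k = 0 \<and> l = 2" using assms(2-4) by arith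
  then show "s = 1" "s' = 1"
    using cell_Suc_disjoint[of k s t s' t'] cell_Suc_disjoint[of l s' t' s t]
      cell_Suc_disjoint[of 2 s t s' t'] cell_Suc_disjoint[of 2 s' t' s t]
      cell_period_3[of 0 s t] cell_period_3[of 0 s' t'] assms by (auto simp: numeral_3_eq_3)
qed

subsection \<open>Edges as pairs of spirals\<close>

text \<open>
  The vertices \<open>j < h\<close> lie outside the triangle of circles and the others inside.  An edge
  from part \<open>k\<close> to part \<open>k + 1\<close> approaches circle \<open>k + 1\<close> at angle \<open>1\<close>; it is reached
  from the outer vertices by turning negatively, i.e. at the equivalent angle \<open>-5\<close>.
  Adding 6 to the angles of outer vertices makes these turns comparable.
\<close>

definition vertex_angle :: "nat \<Rightarrow> nat \<Rightarrow> real" where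
  "vertex_angle h j = (if j < h then - 1 - 1 / (real j + 2) else 2 / 3 - 1 / (3 * (real j + 2)))"

definition lifted_angle :: "nat \<Rightarrow> nat \<Rightarrow> real" where
  "lifted_angle h j = (if j < h then vertex_angle h j + 6 else vertex_angle h j)"

definition prev_port :: "nat \<Rightarrow> nat \<Rightarrow> real" where
  "prev_port h j = (if j < h then - 5 else 1)"

text \<open>
  The edge through the port is offset by a slot in lexicographic order, which prevents
  crossings near the circle \<open>k\<close> and leaves only the forced ones near circle \<open>k + 1\<close>.
\<close>

definition slot :: "nat \<Rightarrow> nat \<Rightarrow> nat \<Rightarrow> nat \<Rightarrow> real" where
  "slot a h i j = (real i + 1 - lifted_angle h j / 6) / (4 * real a)"

text \<open>Inner angles lie between the ports at 0 and 1. The reciprocals let angles increase with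
  \<open>j\<close> inside intervals independent of the number of vertices; lifted outer angles lie
  between \<open>9/2\<close> and \<open>5\<close>, above all inner ones.\<close>

lemma vertex_angle_bounds:
  "j < h \<Longrightarrow> - 3 / 2 \<le> vertex_angle h j" "j < h \<Longrightarrow> vertex_angle h j < - 1"
  "h \<le> j \<Longrightarrow> 1 / 2 \<le> vertex_angle h j" "h \<le> j \<Longrightarrow> vertex_angle h j < 2 / 3"
  by (auto simp: vertex_angle_def divide_simps)

lemma vertex_angle_less:
  assumes "i < j"
  shows "vertex_angle h i < vertex_angle h j"
proof (cases "i < h \<and> h \<le> j")
  case True
  then show ?thesis
    using vertex_angle_bounds(2)[of i h] vertex_angle_bounds(3)[of h j] by linarith
next
  case False
  have "1 / (real j + 2) < 1 / (real i + 2)"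
    using assms by (intro divide_strict_left_mono) auto
  moreover have "1 / (3 * (real j + 2)) < 1 / (3 * (real i + 2))"
    using assms by (intro divide_strict_left_mono) auto
  ultimately show ?thesis
    using assms False unfolding vertex_angle_def by (auto simp: not_less)
qed

lemma vertex_angle_less_iff: "vertex_angle h i < vertex_angle h j \<longleftrightarrow> i < j"
  using vertex_angle_less[of i j h] vertex_angle_less[of j i h] by (cases i j rule: linorder_cases) auto

lemma vertex_angle_range: "- 3 / 2 \<le> vertex_angle h j" "vertex_angle h j < 2 / 3"
proof -
  have "- 3 / 2 \<le> vertex_angle h j \<and> vertex_angle h j < 2 / 3"
  proof (cases "j < h")
    case True
    then show ?thesis using vertex_angle_bounds(1,2)[of j h] by linarith
  next
    case False
    then show ?thesis using vertex_angle_bounds(3,4)[of h j] by linarith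
  qed
  then show "- 3 / 2 \<le> vertex_angle h j" "vertex_angle h j < 2 / 3" by blast+
qed

lemma lifted_angle_range: "1 / 2 \<le> lifted_angle h j" "lifted_angle h j < 5"
proof -
  have "1 / 2 \<le> lifted_angle h j \<and> lifted_angle h j < 5"
  proof (cases "j < h")
    case True
    then have "lifted_angle h j = vertex_angle h j + 6" by (simp add: lifted_angle_def)
    then show ?thesis using vertex_angle_bounds(1,2)[OF True] by linarith
  next
    case False
    then have "lifted_angle h j = vertex_angle h j" by (simp add: lifted_angle_def)
    then show ?thesis using vertex_angle_bounds(3,4)[of h j] False by linarith
  qed
  then show "1 / 2 \<le> lifted_angle h j" "lifted_angle h j < 5" by blast+
qed

lemma lifted_angle_inj: "lifted_angle h i = lifted_angle h j \<longleftrightarrow> i = j"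
proof -
  have "i = j" if e: "lifted_angle h i = lifted_angle h j"
  proof -
    have "i < h \<longleftrightarrow> j < h"
    proof (rule ccontr)
      assume "\<not> ?thesis"
      then consider "i < h" "h \<le> j" | "j < h" "h \<le> i" by linarith
      then show False
        using e vertex_angle_bounds(1,2)[of i h] vertex_angle_bounds(1,2)[of j h]
          vertex_angle_bounds(3,4)[of h i] vertex_angle_bounds(3,4)[of h j]
        by cases (simp_all add: lifted_angle_def)
    qed
    then have "vertex_angle h i = vertex_angle h j"
      using e by (simp add: lifted_angle_def split: if_splits)
    then show ?thesis
      using vertex_angle_less_iff[of h i j] vertex_angle_less_iff[of h j i] by auto
  qed
  then show ?thesis by auto
qed

text \<open>The bound \<open>1/4\<close> keeps slots inside the port
  \<open>\<bar>t\<bar> \<le> 1/2\<close> and the sum of two slots below 1, the distance of the two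
  ports.\<close>

lemma slot_bounds:
  assumes "i < a"
  shows "0 < slot a h i j" "slot a h i j < 1 / 4"
proof -
  have "real i + 1 \<le> real a" using assms by simp
  then have *: "0 < real i + 1 - lifted_angle h j / 6" "real i + 1 - lifted_angle h j / 6 < real a"
    using lifted_angle_range[of h j] by auto
  then show "0 < slot a h i j" "slot a h i j < 1 / 4"
    using assms by (auto simp: slot_def divide_simps)
qed

text \<open>Division by 6 makes the angle term less than 1, so \<open>i\<close> decides first. For
  equal \<open>i\<close> a larger lifted angle gets the smaller slot, hence the larger arrival angle
  \<open>1 - slot\<close>: edges from one vertex arrive in the order of their ends.\<close>

lemma slot_less:
  assumes "0 < a" "i < i' \<or> i = i' \<and> lifted_angle h j' < lifted_angle h j"
  shows "slot a h i j < slot a h i' j'"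
proof -
  have "real i + 1 \<le> real i' \<or> i = i' \<and> lifted_angle h j' < lifted_angle h j"
    using assms(2) by auto
  then have "real i + 1 - lifted_angle h j / 6 < real i' + 1 - lifted_angle h j' / 6"
    using lifted_angle_range[of h j] lifted_angle_range[of h j'] by auto
  then show ?thesis using assms(1) unfolding slot_def by (intro divide_strict_right_mono) auto
qed

definition nxt :: "nat \<Rightarrow> nat" where "nxt k = Suc k mod 3"

lemma nxt: "nxt k < 3" "k < 3 \<Longrightarrow> nxt k \<noteq> k" "k < 3 \<Longrightarrow> nxt (nxt (nxt k)) = k"
  "nxt 0 = 1" "nxt 1 = 2" "nxt 2 = 0"
  by (auto simp: nxt_def) presburger+

lemma cell_nxt:
  assumes "k < 3"
  shows "cell (nxt k) s t = cell (Suc k) s t"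
proof (cases "k = 2")
  case True
  have "(0::nat) + 3 = Suc 2" by simp
  then have "cell (Suc 2) s t = cell 0 s t" using cell_period_3[of 0 s t] by metis
  then show ?thesis using True nxt(6) by metis
next
  case False
  then have "nxt k = Suc k" using assms by (simp add: nxt_def)
  then show ?thesis by simp
qed

definition edge_slot :: "nat list \<Rightarrow> nat \<Rightarrow> nat \<Rightarrow> nat \<Rightarrow> real" where
  "edge_slot ns k i j = slot (ns ! k) (ns ! nxt k div 2) i j"

definition out_strand :: "nat list \<Rightarrow> nat \<Rightarrow> nat \<Rightarrow> nat \<Rightarrow> real \<Rightarrow> complex" where
  "out_strand ns k i j = strand k (vertex_angle (ns ! k div 2) i) (edge_slot ns k i j)"

text \<open>Like the out strand it runs from its circle to the bisector. Its final angle is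
  \<open>1 - edge_slot\<close> up to the period 6, as \<open>cell_port\<close> requires.\<close>

definition in_strand :: "nat list \<Rightarrow> nat \<Rightarrow> nat \<Rightarrow> nat \<Rightarrow> real \<Rightarrow> complex" where
  "in_strand ns k i j = strand (nxt k) (vertex_angle (ns ! nxt k div 2) j)
     (prev_port (ns ! nxt k div 2) j - edge_slot ns k i j)"

definition edge_path :: "nat list \<Rightarrow> nat \<Rightarrow> nat \<Rightarrow> nat \<Rightarrow> real \<Rightarrow> complex" where
  "edge_path ns k i j = out_strand ns k i j +++ reversepath (in_strand ns k i j)"

text \<open>Shifting both end angles by 6 leaves the curve unchanged, and then the strands of inner
  and outer vertices all end just below angle 1.\<close>

lemma in_strand_lifted:
  "in_strand ns k i j s =
     cell (nxt k) s ((1 - s) * lifted_angle (ns ! nxt k div 2) j + s * (1 - edge_slot ns k i j))"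
proof (cases "j < ns ! nxt k div 2")
  case True
  have "(1 - s) * lifted_angle (ns ! nxt k div 2) j + s * (1 - edge_slot ns k i j)
      = ((1 - s) * vertex_angle (ns ! nxt k div 2) j + s * (prev_port (ns ! nxt k div 2) j - edge_slot ns k i j)) + 6 * of_int 1"
    using True by (simp add: lifted_angle_def prev_port_def algebra_simps)
  then show ?thesis unfolding in_strand_def strand_def by (simp only: cell_period)
next
  case False
  then show ?thesis by (simp add: in_strand_def strand_def lifted_angle_def prev_port_def)
qed

lemma strands_meet:
  assumes "k < 3" "i < ns ! k"
  shows "out_strand ns k i j 1 = in_strand ns k i j 1"
proof -
  have "\<bar>edge_slot ns k i j\<bar> \<le> 1/2"
    using slot_bounds[OF assms(2), of "ns ! nxt k div 2" j] by (simp add: edge_slot_def)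
  then show ?thesis
    using cell_port[of "edge_slot ns k i j" k] cell_nxt[OF assms(1)]
    by (simp add: in_strand_lifted out_strand_def strand_def)
qed

lemma edge_path_ends:
  "pathstart (edge_path ns k i j) = cell k 0 (vertex_angle (ns ! k div 2) i)"
  "pathfinish (edge_path ns k i j) = cell (nxt k) 0 (vertex_angle (ns ! nxt k div 2) j)"
  by (simp_all add: edge_path_def out_strand_def in_strand_def strand_ends)

lemma arc_edge_path:
  assumes "k < 3" "i < ns ! k"
  shows "arc (edge_path ns k i j)"
  unfolding edge_path_def
proof (rule arc_join)
  have f: "pathfinish (out_strand ns k i j) = pathfinish (in_strand ns k i j)"
    using strands_meet[OF assms] by (simp add: pathfinish_def)
  show "arc (out_strand ns k i j)" "arc (reversepath (in_strand ns k i j))"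
    by (simp_all add: out_strand_def in_strand_def arc_strand arc_reversepath)
  show "pathfinish (out_strand ns k i j) = pathstart (reversepath (in_strand ns k i j))"
    using f by simp
  show "path_image (out_strand ns k i j) \<inter> path_image (reversepath (in_strand ns k i j))
      \<subseteq> {pathstart (reversepath (in_strand ns k i j))}"
  proof
    fix z assume "z \<in> path_image (out_strand ns k i j) \<inter> path_image (reversepath (in_strand ns k i j))"
    then have "z \<in> path_image (out_strand ns k i j)" "z \<in> path_image (in_strand ns k i j)"
      by simp_all
    then obtain s s' where s: "0 \<le> s" "s \<le> 1" "z = out_strand ns k i j s"
      "0 \<le> s'" "s' \<le> 1" "z = in_strand ns k i j s'"
      unfolding path_image_def by auto
    have "s' = 1"
    proof (rule cell_neq_disjoint(2))
      show "cell k s ((1 - s) * vertex_angle (ns ! k div 2) i + s * edge_slot ns k i j) =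
        cell (nxt k) s' ((1 - s') * lifted_angle (ns ! nxt k div 2) j + s' * (1 - edge_slot ns k i j))"
        using s by (simp add: in_strand_lifted out_strand_def strand_def)
    qed (use s nxt(1)[of k] nxt(2)[OF assms(1)] assms(1) in auto)
    then show "z \<in> {pathstart (reversepath (in_strand ns k i j))}"
      using s by (simp add: pathfinish_def)
  qed
qed

lemma edge_path_interiorE:
  assumes "z \<in> path_interior (edge_path ns k i j)"
  obtains s where "0 < s" "s \<le> 1" "z = out_strand ns k i j s"
  | s where "0 < s" "s \<le> 1" "z = in_strand ns k i j s"
proof -
  have z: "z \<in> path_image (edge_path ns k i j)"
    "z \<noteq> cell k 0 (vertex_angle (ns ! k div 2) i)"
    "z \<noteq> cell (nxt k) 0 (vertex_angle (ns ! nxt k div 2) j)"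
    using assms by (simp_all add: path_interior_def edge_path_ends)
  have "path_image (edge_path ns k i j) \<subseteq> path_image (out_strand ns k i j) \<union> path_image (in_strand ns k i j)"
    unfolding edge_path_def using path_image_join_subset[of "out_strand ns k i j" "reversepath (in_strand ns k i j)"]
    by simp
  then obtain s where s: "0 \<le> s" "s \<le> 1" "z = out_strand ns k i j s \<or> z = in_strand ns k i j s"
    using z(1) unfolding path_image_def by fastforce
  have "s \<noteq> 0"
    using s z(2,3) by (auto simp: out_strand_def in_strand_def strand_def)
  then have "0 < s" using s(1) by simp
  show ?thesis
  proof (cases "z = out_strand ns k i j s")
    case True
    then show ?thesis using that(1) \<open>0 < s\<close> s(2) by blast
  next
    case False
    then have "z = in_strand ns k i j s" using s(3) by blast
    then show ?thesis using that(2) \<open>0 < s\<close> s(2) by blast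
  qed
qed

lemma cell_0_neq:
  assumes "cell k s t = cell l 0 t'" "0 \<le> s" "s \<le> 1" "k < 3" "l < 3"
  shows "s = 0 \<and> k = l"
proof (cases "k = l")
  case True
  then show ?thesis using cell_inj[of k s t 0 t'] assms by auto
next
  case False
  then show ?thesis using cell_neq_disjoint(2)[of k s t l 0 t'] assms by auto
qed

lemma edge_path_interior_not_on_circle:
  assumes "z \<in> path_interior (edge_path ns k i j)" "k < 3" "l < 3"
  shows "z \<notin> range (cell l 0)"
  using assms(1)
proof (cases rule: edge_path_interiorE)
  case (1 s)
  then show ?thesis using cell_0_neq[of k s _ l] assms by (auto simp: out_strand_def strand_def)
next
  case (2 s)
  then show ?thesis using cell_0_neq[of "nxt k" s _ l] assms nxt by (auto simp: in_strand_def strand_def)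
qed

section \<open>Where two edges can meet\<close>

lemma convex_combination_less:
  fixes a b c d s :: real
  assumes "0 \<le> s" "s \<le> 1" "a < c" "b < c"
  shows "(1 - s) * a + s * b < c"
  using convex_bound_lt[of a c b "1 - s" s] assms by simp

lemma convex_combination_greater:
  fixes a b c d s :: real
  assumes "0 \<le> s" "s \<le> 1" "c < a" "c < b"
  shows "c < (1 - s) * a + s * b"
  using convex_bound_lt[of "-a" "-c" "-b" "1 - s" s] assms by simp

lemma cell_inj_bounds:
  assumes "cell k s t = cell k s' t'" "0 < s" "0 < s'" "lo < t" "t < hi" "lo' < t'" "t' < hi'"
    "hi - lo' \<le> 6" "hi' - lo \<le> 6"
  shows "s = s'" "t = t'"
  using cell_inj_lt[OF assms(1)] assms(2-) by (simp_all add: abs_if)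

text \<open>Near circle \<open>k\<close> vertex angles and slots are ordered alike, so out strands
  do not meet; edges of one type cross only in the cell of circle \<open>nxt k\<close>.\<close>

lemma same_type_crossing:
  assumes k: "k < 3" and ij: "i < ns ! k" "i' < ns ! k" "(i, j) \<noteq> (i', j')"
    and z: "z \<in> path_interior (edge_path ns k i j)" "z \<in> path_interior (edge_path ns k i' j')"
  obtains s where "0 < s" "s \<le> 1" "z = in_strand ns k i j s"
    "(1 - s) * (lifted_angle (ns ! nxt k div 2) j - lifted_angle (ns ! nxt k div 2) j')
       = s * (edge_slot ns k i j - edge_slot ns k i' j')"
proof -
  let ?v = "vertex_angle (ns ! k div 2)" and ?l = "lifted_angle (ns ! nxt k div 2)"
  have sl: "0 < edge_slot ns k i j" "edge_slot ns k i j < 1/4" "0 < edge_slot ns k i' j'" "edge_slot ns k i' j' < 1/4"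
    using slot_bounds ij by (auto simp: edge_slot_def)
  have b: "-2 < (1 - s) * ?v i + s * edge_slot ns k i j" "(1 - s) * ?v i + s * edge_slot ns k i j < 2/3"
     "-2 < (1 - s) * ?v i' + s * edge_slot ns k i' j'" "(1 - s) * ?v i' + s * edge_slot ns k i' j' < 2/3"
    if s: "0 < s" "s \<le> 1" for s
  proof -
    have v: "-2 < ?v x" "?v x < 2/3" for x
      using vertex_angle_range[of "ns ! k div 2" x] by simp_all
    have s': "0 \<le> s" using s by simp
    have e: "-2 < edge_slot ns k i j" "edge_slot ns k i j < 2/3" "-2 < edge_slot ns k i' j'" "edge_slot ns k i' j' < 2/3"
      using sl by linarith+
    show "-2 < (1 - s) * ?v i + s * edge_slot ns k i j" "-2 < (1 - s) * ?v i' + s * edge_slot ns k i' j'"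
      by (rule convex_combination_greater[OF s' s(2) v(1)], rule e)+
    show "(1 - s) * ?v i + s * edge_slot ns k i j < 2/3" "(1 - s) * ?v i' + s * edge_slot ns k i' j' < 2/3"
      by (rule convex_combination_less[OF s' s(2) v(2)], rule e)+
  qed
  have c: "0 < (1 - s) * ?l j + s * (1 - edge_slot ns k i j)" "(1 - s) * ?l j + s * (1 - edge_slot ns k i j) < 5"
     "0 < (1 - s) * ?l j' + s * (1 - edge_slot ns k i' j')" "(1 - s) * ?l j' + s * (1 - edge_slot ns k i' j') < 5"
    if s: "0 < s" "s \<le> 1" for s
  proof -
    have v: "0 < ?l x" "?l x < 5" for x
      using lifted_angle_range[of "ns ! nxt k div 2" x] by simp_all
    have s': "0 \<le> s" using s by simp
    show "0 < (1 - s) * ?l j + s * (1 - edge_slot ns k i j)" "0 < (1 - s) * ?l j' + s * (1 - edge_slot ns k i' j')"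
      using sl by (simp_all add: convex_combination_greater[OF s' s(2) v(1)])
    show "(1 - s) * ?l j + s * (1 - edge_slot ns k i j) < 5" "(1 - s) * ?l j' + s * (1 - edge_slot ns k i' j') < 5"
      using sl by (simp_all add: convex_combination_less[OF s' s(2) v(2)])
  qed
  have no_out: False if s: "0 < s" "s \<le> 1" "0 < s'" "s' \<le> 1"
    and eq: "out_strand ns k i j s = out_strand ns k i' j' s'" for s s'
  proof -
    have "s = s'" and t: "(1 - s) * ?v i + s * edge_slot ns k i j = (1 - s') * ?v i' + s' * edge_slot ns k i' j'"
      by (rule cell_inj_bounds[OF eq[unfolded out_strand_def strand_def] s(1,3)
            b(1,2)[OF s(1,2)] b(3,4)[OF s(3,4)]]; simp)+
    then have t: "(1 - s) * (?v i - ?v i') + s * (edge_slot ns k i j - edge_slot ns k i' j') = 0"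
      by (simp add: algebra_simps)
    consider "i < i'" | "i' < i" | "i = i'" "j \<noteq> j'" using ij(3) by fastforce
    then show False
    proof cases
      case 1
      then have "(1 - s) * (?v i - ?v i') \<le> 0" "s * (edge_slot ns k i j - edge_slot ns k i' j') < 0"
        using s vertex_angle_less[OF 1, of "ns ! k div 2"] slot_less[of "ns ! k" i i'] ij(1)
        by (auto simp: mult_le_0_iff mult_less_0_iff edge_slot_def)
      then show False using t by linarith
    next
      case 2
      then have "(1 - s) * (?v i - ?v i') \<ge> 0" "s * (edge_slot ns k i j - edge_slot ns k i' j') > 0"
        using s vertex_angle_less[OF 2, of "ns ! k div 2"] slot_less[of "ns ! k" i' i] ij(1)
        by (auto simp: zero_le_mult_iff zero_less_mult_iff edge_slot_def)
      then show False using t by linarith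
    next
      case 3
      have "edge_slot ns k i j \<noteq> edge_slot ns k i' j'"
        using 3 slot_less[of "ns ! k" i i "ns ! nxt k div 2" j j'] slot_less[of "ns ! k" i i "ns ! nxt k div 2" j' j] ij(1)
          lifted_angle_inj[of "ns ! nxt k div 2" j j'] unfolding edge_slot_def
        by (cases "?l j" "?l j'" rule: linorder_cases) auto
      then show False using t 3 s by simp
    qed
  qed
  \<comment> \<open>Out and in strands lie in different cells and share at most points with
    \<open>s = 1\<close>, which each edge also has on its in strand.\<close>
  have out_in: "s = 1" if "0 < s" "s \<le> 1" "0 < s'" "s' \<le> 1" 
    "out_strand ns k a b s = in_strand ns k c d s'" for s s' a b c d
    using cell_neq_disjoint(1)[OF that(5)[unfolded out_strand_def in_strand_def strand_def]] that k nxt(1,2)[of k]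
    by auto
  have ex: "\<exists>s. 0 < s \<and> s \<le> 1 \<and> z = in_strand ns k i j s" if "z \<in> path_interior (edge_path ns k i' j')" 
    "z \<in> path_interior (edge_path ns k i j)" "i < ns ! k" "i' < ns ! k" 
    "\<And>s s'. 0 < s \<Longrightarrow> s \<le> 1 \<Longrightarrow> 0 < s' \<Longrightarrow> s' \<le> 1 \<Longrightarrow> out_strand ns k i j s \<noteq> out_strand ns k i' j' s'" for i j i' j'
    using that(2)
  proof (cases rule: edge_path_interiorE)
    case (1 s)
    from that(1) show ?thesis
    proof (cases rule: edge_path_interiorE)
      case (1 s')
      then show ?thesis using that(5)[of s s'] \<open>0 < s\<close> \<open>s \<le> 1\<close> \<open>z = out_strand ns k i j s\<close> by simp
    next
      case (2 s')
      then have "s = 1" using out_in 1 by metis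
      then show ?thesis using 1 strands_meet[OF k that(3)] by (intro exI[of _ 1]) simp
    qed
  next
    case (2 s)
    then show ?thesis by blast
  qed
  obtain s where s: "0 < s" "s \<le> 1" "z = in_strand ns k i j s"
    using ex[OF z(2,1) ij(1,2)] no_out by blast
  obtain s' where s': "0 < s'" "s' \<le> 1" "z = in_strand ns k i' j' s'"
    using ex[OF z(1,2) ij(2,1)] no_out by metis
  have e: "cell (nxt k) s ((1 - s) * ?l j + s * (1 - edge_slot ns k i j))
    = cell (nxt k) s' ((1 - s') * ?l j' + s' * (1 - edge_slot ns k i' j'))"
    using s(3) s'(3) by (simp add: in_strand_lifted)
  have "s = s'" and "(1 - s) * ?l j + s * (1 - edge_slot ns k i j) = (1 - s') * ?l j' + s' * (1 - edge_slot ns k i' j')"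
    by (rule cell_inj_bounds[OF e s(1) s'(1) c(1,2)[OF s(1,2)] c(3,4)[OF s'(1,2)]]; simp)+
  then have "(1 - s) * (?l j - ?l j') = s * (edge_slot ns k i j - edge_slot ns k i' j')"
    by (simp add: algebra_simps)
  then show ?thesis using that s by blast
qed

text \<open>The edges share only the cell of circle \<open>nxt q\<close>, which one leaves by its
  out strand and the other enters by its in strand. Other pairs of strands lie in different cells
  and can meet only at \<open>s = 1\<close>, a point that \<open>strands_meet\<close> transfers to
  these two.\<close>

lemma mixed_type_crossing:
  assumes q: "q < 3" and ij: "i < ns ! nxt q" "l < ns ! q"
    and z: "z \<in> path_interior (edge_path ns (nxt q) i j)" "z \<in> path_interior (edge_path ns q l i')"
  obtains s where "0 < s" "s \<le> 1" "z = out_strand ns (nxt q) i j s"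
    "(1 - s) * (vertex_angle (ns ! nxt q div 2) i - vertex_angle (ns ! nxt q div 2) i')
       = s * (prev_port (ns ! nxt q div 2) i' - edge_slot ns (nxt q) i j - edge_slot ns q l i')"
proof -
  let ?k = "nxt q"
  let ?h = "ns ! ?k div 2"
  let ?x = "edge_slot ns ?k i j" and ?y = "edge_slot ns q l i'"
  have k: "?k < 3" "?k \<noteq> q" "nxt ?k < 3" "nxt ?k \<noteq> ?k" "nxt ?k \<noteq> q"
    using q by (auto simp: nxt_def) presburger+
  have sl: "0 < ?x" "?x < 1/4" "0 < ?y" "?y < 1/4"
    using slot_bounds ij by (auto simp: edge_slot_def)
  have out_e: "\<exists>s. 0 < s \<and> s \<le> 1 \<and> z = out_strand ns ?k i j s"
    using z(1)
  proof (cases rule: edge_path_interiorE)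
    case (1 s)
    then show ?thesis by blast
  next
    case e: (2 s)
    have "s = 1" using z(2)
    proof (cases rule: edge_path_interiorE)
      case (1 s')
      then have "in_strand ns ?k i j s = out_strand ns q l i' s'" using e by simp
      from cell_neq_disjoint(1)[OF this[unfolded in_strand_def out_strand_def strand_def]]
      show ?thesis using e 1 k q by auto
    next
      case (2 s')
      then have "in_strand ns ?k i j s = in_strand ns q l i' s'" using e by simp
      from cell_neq_disjoint(1)[OF this[unfolded in_strand_def strand_def]]
      show ?thesis using e 2 k q by auto
    qed
    then show ?thesis using e strands_meet[OF k(1) ij(1)] by (intro exI[of _ 1]) simp
  qed
  have in_f: "\<exists>s. 0 < s \<and> s \<le> 1 \<and> z = in_strand ns q l i' s"
    using z(2)
  proof (cases rule: edge_path_interiorE)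
    case (2 s)
    then show ?thesis by blast
  next
    case (1 s)
    obtain s' where s': "0 < s'" "s' \<le> 1" "z = out_strand ns ?k i j s'" using out_e by blast
    then have "out_strand ns q l i' s = out_strand ns ?k i j s'" using 1 by simp
    from cell_neq_disjoint(1)[OF this[unfolded out_strand_def strand_def]]
    have "s = 1" using 1 s' k q by auto
    then show ?thesis using 1 strands_meet[OF q ij(2)] by (intro exI[of _ 1]) simp
  qed
  obtain s where s: "0 < s" "s \<le> 1" "z = out_strand ns ?k i j s" using out_e by blast
  obtain s' where s': "0 < s'" "s' \<le> 1" "z = in_strand ns q l i' s'" using in_f by blast
  have e: "cell ?k s ((1 - s) * vertex_angle ?h i + s * ?x)
    = cell ?k s' ((1 - s') * vertex_angle ?h i' + s' * (prev_port ?h i' - ?y))"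
    using s(3) s'(3) by (simp add: in_strand_def out_strand_def strand_def)
  have b: "- 2 < (1 - s) * vertex_angle ?h i + s * ?x" "(1 - s) * vertex_angle ?h i + s * ?x < 2/3"
  proof -
    have s0: "0 \<le> s" using s by simp
    have v: "- 2 < vertex_angle ?h i" "vertex_angle ?h i < 2/3" "- 2 < ?x" "?x < 2/3"
      using vertex_angle_range[of ?h i] sl by linarith+
    show "- 2 < (1 - s) * vertex_angle ?h i + s * ?x"
      by (rule convex_combination_greater[OF s0 s(2) v(1,3)])
    show "(1 - s) * vertex_angle ?h i + s * ?x < 2/3"
      by (rule convex_combination_less[OF s0 s(2) v(2,4)])
  qed
  \<comment> \<open>The lower bound is the port \<open>- 5\<close> minus the slot bound
    \<open>1/4\<close>. Against the window from \<open>- 2\<close> to \<open>2/3\<close> of the out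
    strand, angles still differ by less than 6.\<close>
  have c: "- 21/4 < (1 - s') * vertex_angle ?h i' + s' * (prev_port ?h i' - ?y)"
    "(1 - s') * vertex_angle ?h i' + s' * (prev_port ?h i' - ?y) < 1"
  proof -
    have "- 5 \<le> prev_port ?h i'" "prev_port ?h i' \<le> 1" by (simp_all add: prev_port_def)
    then have p: "- 21/4 < prev_port ?h i' - ?y" "prev_port ?h i' - ?y < 1" using sl by linarith+
    have v: "- 21/4 < vertex_angle ?h i'" "vertex_angle ?h i' < 1"
      using vertex_angle_range[of ?h i'] by simp_all
    have s0: "0 \<le> s'" using s' by simp
    show "- 21/4 < (1 - s') * vertex_angle ?h i' + s' * (prev_port ?h i' - ?y)"
      by (rule convex_combination_greater[OF s0 s'(2) v(1) p(1)])
    show "(1 - s') * vertex_angle ?h i' + s' * (prev_port ?h i' - ?y) < 1"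
      by (rule convex_combination_less[OF s0 s'(2) v(2) p(2)])
  qed
  have "s = s'" and "(1 - s) * vertex_angle ?h i + s * ?x = (1 - s') * vertex_angle ?h i' + s' * (prev_port ?h i' - ?y)"
    by (rule cell_inj_bounds[OF e s(1) s'(1) b c]; simp)+
  then have "(1 - s) * (vertex_angle ?h i - vertex_angle ?h i') = s * (prev_port ?h i' - ?x - ?y)"
    by (simp add: algebra_simps)
  then show ?thesis using that s by blast
qed

section \<open>Assembling the drawing\<close>

lemma nxt_nxt_neq: "k < 3 \<Longrightarrow> nxt (nxt k) \<noteq> k"
  unfolding nxt_def by presburger

lemma nxt_cases:
  assumes "k < 3" "l < 3" "k \<noteq> l"
  shows "l = nxt k \<or> k = nxt l"
proof -
  have "k = 0 \<or> k = 1 \<or> k = 2" "l = 0 \<or> l = 1 \<or> l = 2" using assms(1,2) by linarith+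
  then show ?thesis using assms(3) by (elim disjE) (simp_all add: nxt_def)
qed

text \<open>Directing every edge to the cyclically next part represents it uniquely, so the choice
  in \<open>drawing_path\<close> is unambiguous.\<close>

definition cyc_edge :: "nat \<Rightarrow> nat \<Rightarrow> nat \<Rightarrow> (nat \<times> nat) set" where
  "cyc_edge k i j = {(k, i), (nxt k, j)}"

definition drawing_pos :: "nat list \<Rightarrow> nat \<times> nat \<Rightarrow> complex" where
  "drawing_pos ns = (\<lambda>(k, j). cell k 0 (vertex_angle (ns ! k div 2) j))"

definition drawing_path :: "nat list \<Rightarrow> (nat \<times> nat) set \<Rightarrow> real \<Rightarrow> complex" where
  "drawing_path ns e =
     (case SOME (k, i, j). k < 3 \<and> e = cyc_edge k i j of (k, i, j) \<Rightarrow> edge_path ns k i j)"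

lemma cyc_edge_inj:
  assumes "k < 3" "k' < 3" "cyc_edge k i j = cyc_edge k' i' j'"
  shows "k = k' \<and> i = i' \<and> j = j'"
proof -
  have "(k, i) = (k', i') \<and> (nxt k, j) = (nxt k', j') \<or> (k, i) = (nxt k', j') \<and> (nxt k, j) = (k', i')"
    using assms(3) unfolding cyc_edge_def by (simp only: doubleton_eq_iff)
  moreover have "nxt (nxt k) \<noteq> k" by (rule nxt_nxt_neq[OF assms(1)])
  ultimately show ?thesis by auto
qed

lemma drawing_path_cyc_edge:
  assumes "k < 3"
  shows "drawing_path ns (cyc_edge k i j) = edge_path ns k i j"
proof -
  have "(SOME (k', i', j'). k' < 3 \<and> cyc_edge k i j = cyc_edge k' i' j') = (k, i, j)"
  proof (rule some_equality)
    fix x assume "case x of (k', i', j') \<Rightarrow> k' < 3 \<and> cyc_edge k i j = cyc_edge k' i' j'"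
    moreover obtain k' i' j' where x: "x = (k', i', j')" by (cases x)
    ultimately have "k' < 3" "cyc_edge k i j = cyc_edge k' i' j'" by simp_all
    then have "k = k' \<and> i = i' \<and> j = j'" by (rule cyc_edge_inj[OF assms])
    then show "x = (k, i, j)" using x by simp
  qed (use assms in simp)
  then show ?thesis by (simp add: drawing_path_def)
qed

lemma multipartite_edges_3:
  assumes "length ns = 3"
  shows "multipartite_edges ns = {cyc_edge k i j | k i j. k < 3 \<and> i < ns ! k \<and> j < ns ! nxt k}"
proof
  show "{cyc_edge k i j | k i j. k < 3 \<and> i < ns ! k \<and> j < ns ! nxt k} \<subseteq> multipartite_edges ns"
  proof
    fix e assume "e \<in> {cyc_edge k i j | k i j. k < 3 \<and> i < ns ! k \<and> j < ns ! nxt k}"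
    then obtain k i j where e: "e = cyc_edge k i j" "k < 3" "i < ns ! k" "j < ns ! nxt k" by blast
    have "e \<in> bip_edges ns k (nxt k)" using e unfolding bip_edges_def cyc_edge_def by blast
    then show "e \<in> multipartite_edges ns"
      using bip_edges_subset[of k ns "nxt k"] e(2) assms nxt(1)[of k] nxt(2)[of k] by auto
  qed
  show "multipartite_edges ns \<subseteq> {cyc_edge k i j | k i j. k < 3 \<and> i < ns ! k \<and> j < ns ! nxt k}"
  proof
    fix e assume "e \<in> multipartite_edges ns"
    then obtain u v where e: "e = {u, v}" "u \<in> multipartite_verts ns" "v \<in> multipartite_verts ns" "fst u \<noteq> fst v"
      unfolding multipartite_edges_def by blast
    obtain k i l j where uv: "u = (k, i)" "v = (l, j)" by (cases u; cases v)
    have *: "k < 3" "i < ns ! k" "l < 3" "j < ns ! l" "k \<noteq> l"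
      using e uv assms by (auto simp: multipartite_verts_def)
    then consider "l = nxt k" | "k = nxt l" using nxt_cases by blast
    then show "e \<in> {cyc_edge k i j | k i j. k < 3 \<and> i < ns ! k \<and> j < ns ! nxt k}"
    proof cases
      case 1
      then have "e = cyc_edge k i j" "j < ns ! nxt k" using e(1) uv * by (simp_all add: cyc_edge_def)
      then show ?thesis using * by blast
    next
      case 2
      then have "e = cyc_edge l j i" "i < ns ! nxt l" using e(1) uv * by (simp_all add: cyc_edge_def insert_commute)
      then show ?thesis using * by blast
    qed
  qed
qed

text \<open>
  Two spirals at the same relative distance \<open>s\<close> meet when a difference \<open>c\<close> of initial
  angles is balanced by a difference \<open>d\<close> of final angles.
\<close>

lemma balance_sign:
  fixes s c d :: real
  assumes "0 < s" "s \<le> 1" "(1 - s) * c = s * d" "0 < d"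
  shows "0 < c"
proof -
  have "0 < (1 - s) * c" using assms by simp
  then show ?thesis using assms(2) by (simp add: zero_less_mult_iff)
qed

lemma balance_unique:
  fixes s s' c d :: real
  assumes "0 < s" "s \<le> 1" "(1 - s) * c = s * d" "0 < s'" "s' \<le> 1" "(1 - s') * c = s' * d" "d \<noteq> 0"
  shows "s = s'"
proof -
  have c: "c \<noteq> 0" using assms(1,3,7) by auto
  have "s' * ((1 - s) * c) = s * ((1 - s') * c)"
    unfolding assms(3,6) by (simp add: mult.left_commute)
  then have "(s' - s) * c = 0" by (simp add: algebra_simps)
  then show ?thesis using c by simp
qed

section \<open>Which pairs of edges cross, and how often\<close>

lemma edge_slot_less:
  assumes "i < ns ! k" "i < i' \<or> i = i' \<and> lifted_angle (ns ! nxt k div 2) j' < lifted_angle (ns ! nxt k div 2) j"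
  shows "edge_slot ns k i j < edge_slot ns k i' j'"
  unfolding edge_slot_def using assms by (intro slot_less) auto

lemma edge_slot_neq:
  assumes "i < ns ! k" "i' < ns ! k" "(i, j) \<noteq> (i', j')"
  shows "edge_slot ns k i j \<noteq> edge_slot ns k i' j'"
proof -
  let ?l = "lifted_angle (ns ! nxt k div 2)"
  have "?l j \<noteq> ?l j'" if "i = i'" using that assms(3) lifted_angle_inj by auto
  then consider "i < i' \<or> i = i' \<and> ?l j' < ?l j" | "i' < i \<or> i' = i \<and> ?l j < ?l j'" by fastforce
  then show ?thesis
    using edge_slot_less[of i ns k i' j' j] edge_slot_less[of i' ns k i j j'] assms by cases auto
qed

text \<open>A crossing needs slots and lifted angles to differ with the same sign. For edges from
  one vertex the signs are opposite, so \<open>i \<noteq> i'\<close>, and then slots are ordered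
  like \<open>i\<close> and \<open>i'\<close>.\<close>

lemma same_type_order:
  assumes "k < 3" "i < ns ! k" "i' < ns ! k" "(i, j) \<noteq> (i', j')"
    and "z \<in> path_interior (edge_path ns k i j)" "z \<in> path_interior (edge_path ns k i' j')"
  shows "i < i' \<and> lifted_angle (ns ! nxt k div 2) j < lifted_angle (ns ! nxt k div 2) j'
    \<or> i' < i \<and> lifted_angle (ns ! nxt k div 2) j' < lifted_angle (ns ! nxt k div 2) j"
proof -
  let ?l = "lifted_angle (ns ! nxt k div 2)" and ?d = "edge_slot ns k i j - edge_slot ns k i' j'"
  obtain s where s: "0 < s" "s \<le> 1" "(1 - s) * (?l j - ?l j') = s * ?d"
    using same_type_crossing[OF assms] by metis
  then have s': "(1 - s) * (?l j' - ?l j) = s * (- ?d)" by (simp add: algebra_simps)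
  have "?d \<noteq> 0" using edge_slot_neq[OF assms(2,3,4)] by simp
  then consider "0 < ?d" | "0 < - ?d" by linarith
  then show ?thesis
  proof cases
    case 1
    then have "?l j' < ?l j" using balance_sign[OF s] by simp
    moreover have "\<not> (i < i' \<or> i = i')"
      using edge_slot_less[of i ns k i' j' j] 1 assms(2) calculation by auto
    ultimately show ?thesis by auto
  next
    case 2
    then have "?l j < ?l j'" using balance_sign[OF s(1,2) s'] by simp
    moreover have "\<not> (i' < i \<or> i' = i)"
      using edge_slot_less[of i' ns k i j j'] 2 assms(3) calculation by auto
    ultimately show ?thesis by auto
  qed
qed

lemma same_type_unique:
  assumes "k < 3" "i < ns ! k" "i' < ns ! k" "(i, j) \<noteq> (i', j')"
    and "z \<in> path_interior (edge_path ns k i j)" "z \<in> path_interior (edge_path ns k i' j')"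
    and "z' \<in> path_interior (edge_path ns k i j)" "z' \<in> path_interior (edge_path ns k i' j')"
  shows "z = z'"
proof -
  let ?l = "lifted_angle (ns ! nxt k div 2)" and ?d = "edge_slot ns k i j - edge_slot ns k i' j'"
  obtain s where s: "0 < s" "s \<le> 1" "z = in_strand ns k i j s" "(1 - s) * (?l j - ?l j') = s * ?d"
    using same_type_crossing[OF assms(1-6)] by metis
  obtain s' where s': "0 < s'" "s' \<le> 1" "z' = in_strand ns k i j s'" "(1 - s') * (?l j - ?l j') = s' * ?d"
    using same_type_crossing[OF assms(1-4,7,8)] by metis
  have "?d \<noteq> 0" using edge_slot_neq[OF assms(2,3,4)] by simp
  then have "s = s'" by (rule balance_unique[OF s(1,2,4) s'(1,2,4)])
  then show ?thesis using s s' by simp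
qed

text \<open>Two slots add up to less than 1, too little to change the sign of a port: arriving edges
  of inner vertices end above all leaving edges, those of outer vertices below.\<close>

lemma mixed_gap:
  fixes i j l i' :: nat
  assumes "i < ns ! nxt q" "l < ns ! q"
  defines "d \<equiv> prev_port (ns ! nxt q div 2) i' - edge_slot ns (nxt q) i j - edge_slot ns q l i'"
  shows "i' < ns ! nxt q div 2 \<Longrightarrow> d < 0" "ns ! nxt q div 2 \<le> i' \<Longrightarrow> 0 < d"
proof -
  have sl: "0 < edge_slot ns (nxt q) i j" "edge_slot ns (nxt q) i j < 1/4"
    "0 < edge_slot ns q l i'" "edge_slot ns q l i' < 1/4"
    using slot_bounds assms(1,2) by (auto simp: edge_slot_def)
  show "d < 0" if "i' < ns ! nxt q div 2"
  proof -
    have "prev_port (ns ! nxt q div 2) i' = - 5" using that by (simp add: prev_port_def)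
    then show ?thesis using sl unfolding d_def by linarith
  qed
  show "0 < d" if "ns ! nxt q div 2 \<le> i'"
  proof -
    have "prev_port (ns ! nxt q div 2) i' = 1" using that by (simp add: prev_port_def)
    then show ?thesis using sl unfolding d_def by linarith
  qed
qed

text \<open>On the way to its port an arriving edge turns upwards from an inner vertex and downwards
  from an outer one, so it can cross leaving edges only of vertices further along in the same
  half.\<close>

lemma mixed_type_order:
  assumes "q < 3" "i < ns ! nxt q" "l < ns ! q"
    and "z \<in> path_interior (edge_path ns (nxt q) i j)" "z \<in> path_interior (edge_path ns q l i')"
  shows "ns ! nxt q div 2 \<le> i' \<and> i' < i \<or> i < i' \<and> i' < ns ! nxt q div 2"
proof -
  let ?v = "vertex_angle (ns ! nxt q div 2)"
  let ?d = "prev_port (ns ! nxt q div 2) i' - edge_slot ns (nxt q) i j - edge_slot ns q l i'"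
  obtain s where s: "0 < s" "s \<le> 1" "(1 - s) * (?v i - ?v i') = s * ?d"
    using mixed_type_crossing[OF assms] by metis
  then have s': "(1 - s) * (?v i' - ?v i) = s * (- ?d)" by (simp add: algebra_simps)
  show ?thesis
  proof (cases "i' < ns ! nxt q div 2")
    case True
    then have "0 < - ?d" using mixed_gap(1)[of i ns q l i' j] assms by simp
    from balance_sign[OF s(1,2) s' this] have "?v i < ?v i'" by simp
    then show ?thesis using True unfolding vertex_angle_less_iff by simp
  next
    case False
    then have "0 < ?d" using mixed_gap(2)[of i ns q l i' j] assms by simp
    from balance_sign[OF s this] have "?v i' < ?v i" by simp
    then show ?thesis using False unfolding vertex_angle_less_iff by simp
  qed
qed

lemma mixed_type_unique:
  assumes "q < 3" "i < ns ! nxt q" "l < ns ! q"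
    and "z \<in> path_interior (edge_path ns (nxt q) i j)" "z \<in> path_interior (edge_path ns q l i')"
    and "z' \<in> path_interior (edge_path ns (nxt q) i j)" "z' \<in> path_interior (edge_path ns q l i')"
  shows "z = z'"
proof -
  let ?v = "vertex_angle (ns ! nxt q div 2)"
  let ?d = "prev_port (ns ! nxt q div 2) i' - edge_slot ns (nxt q) i j - edge_slot ns q l i'"
  obtain s where s: "0 < s" "s \<le> 1" "z = out_strand ns (nxt q) i j s" "(1 - s) * (?v i - ?v i') = s * ?d"
    using mixed_type_crossing[OF assms(1-5)] by metis
  obtain s' where s': "0 < s'" "s' \<le> 1" "z' = out_strand ns (nxt q) i j s'" "(1 - s') * (?v i - ?v i') = s' * ?d"
    using mixed_type_crossing[OF assms(1-3,6,7)] by metis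
  have "?d \<noteq> 0" using mixed_gap[of i ns q l i' j] assms(2,3) by (cases "i' < ns ! nxt q div 2") auto
  then have "s = s'" by (rule balance_unique[OF s(1,2,4) s'(1,2,4)])
  then show ?thesis using s s' by simp
qed

subsection \<open>Counting the crossings\<close>

definition same_type_pairs :: "nat list \<Rightarrow> nat \<Rightarrow> (nat \<times> nat) set set set" where
  "same_type_pairs ns k = (\<lambda>((i, i'), (j, j')). {cyc_edge k i j, cyc_edge k i' j'}) `
     ({(i, i'). i < ns ! k \<and> i' < ns ! k \<and> i < i'} \<times>
      {(j, j'). j < ns ! nxt k \<and> j' < ns ! nxt k \<and>
         lifted_angle (ns ! nxt k div 2) j < lifted_angle (ns ! nxt k div 2) j'})"

text \<open>The far ends \<open>j\<close> and \<open>l\<close> are free; the ends \<open>i\<close>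
  and \<open>i'\<close> on the shared circle lie in one half, in the order forced by
  \<open>mixed_type_order\<close>.\<close>

definition mixed_type_pairs :: "nat list \<Rightarrow> nat \<Rightarrow> (nat \<times> nat) set set set" where
  "mixed_type_pairs ns q = (\<lambda>((j, l), (i, i')). {cyc_edge (nxt q) i j, cyc_edge q l i'}) `
     (({..<ns ! nxt (nxt q)} \<times> {..<ns ! q}) \<times>
      ({(i, i'). ns ! nxt q div 2 \<le> i' \<and> i' < i \<and> i < ns ! nxt q} \<union> {(i, i'). i < i' \<and> i' < ns ! nxt q div 2}))"

text \<open>Two distinct parts are cyclically consecutive, so every two edges are of equal or mixed
  type. The uniqueness claim also supplies the finiteness that a drawing requires.\<close>

lemma crossing_pair:
  assumes ns: "length ns = 3" and ef: "e \<in> multipartite_edges ns" "f \<in> multipartite_edges ns" "e \<noteq> f"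
    and z: "z \<in> path_interior (drawing_path ns e)" "z \<in> path_interior (drawing_path ns f)"
  shows "{e, f} \<in> (\<Union>k<3. same_type_pairs ns k) \<union> (\<Union>q<3. mixed_type_pairs ns q)"
    and "z' \<in> path_interior (drawing_path ns e) \<Longrightarrow> z' \<in> path_interior (drawing_path ns f) \<Longrightarrow> z = z'"
proof -
  let ?W = "(\<Union>k<3. same_type_pairs ns k) \<union> (\<Union>q<3. mixed_type_pairs ns q)"
  obtain k i j where e: "e = cyc_edge k i j" "k < 3" "i < ns ! k" "j < ns ! nxt k"
    using ef(1) unfolding multipartite_edges_3[OF ns] by blast
  obtain q l i' where f: "f = cyc_edge q l i'" "q < 3" "l < ns ! q" "i' < ns ! nxt q"
    using ef(2) unfolding multipartite_edges_3[OF ns] by blast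
  note pe = drawing_path_cyc_edge[OF e(2), of ns i j, folded e(1)]
  note pf = drawing_path_cyc_edge[OF f(2), of ns l i', folded f(1)]
  have mixed: "{cyc_edge (nxt q) i j, cyc_edge q l i'} \<in> ?W"
    if "q < 3" "i < ns ! nxt q" "j < ns ! nxt (nxt q)" "l < ns ! q"
      "z \<in> path_interior (edge_path ns (nxt q) i j)" "z \<in> path_interior (edge_path ns q l i')" for q i j l i'
  proof -
    have "{cyc_edge (nxt q) i j, cyc_edge q l i'} \<in> mixed_type_pairs ns q"
      unfolding mixed_type_pairs_def
      by (rule image_eqI[where x = "((j, l), (i, i'))"])
        (use mixed_type_order[OF that(1,2,4-6)] that in auto)
    then show ?thesis using that(1) by blast
  qed
  have same_pair: "{cyc_edge k i j, cyc_edge k l i'} \<in> ?W"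
    if "i < l" "lifted_angle (ns ! nxt k div 2) j < lifted_angle (ns ! nxt k div 2) i'"
      "k < 3" "l < ns ! k" "j < ns ! nxt k" "i' < ns ! nxt k" for k i j l i'
  proof -
    have "{cyc_edge k i j, cyc_edge k l i'} \<in> same_type_pairs ns k"
      unfolding same_type_pairs_def
      by (rule image_eqI[where x = "((i, l), (j, i'))"]) (use that in auto)
    then show ?thesis using that(3) by blast
  qed
  consider (same) "q = k" | (next_e) "k = nxt q" | (next_f) "q = nxt k" "q \<noteq> k" 
    using nxt_cases[OF e(2) f(2)] by blast
  then have "{e, f} \<in> ?W \<and> (z' \<in> path_interior (drawing_path ns e) \<longrightarrow> z' \<in> path_interior (drawing_path ns f) \<longrightarrow> z = z')"
  proof cases
    case same
    have ne: "(i, j) \<noteq> (l, i')" using ef(3) e(1) f(1) same by auto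
    have fl: "l < ns ! k" "i' < ns ! nxt k" using f same by simp_all
    have z1: "z \<in> path_interior (edge_path ns k i j)" "z \<in> path_interior (edge_path ns k l i')"
      using z pe pf same by simp_all
    have "{e, f} \<in> ?W"
      using same_type_order[OF e(2,3) fl(1) ne z1]
    proof
      assume "i < l \<and> lifted_angle (ns ! nxt k div 2) j < lifted_angle (ns ! nxt k div 2) i'"
      then show ?thesis using same_pair[of i l k j i'] e(1,2,4) f(1) same fl by simp
    next
      assume "l < i \<and> lifted_angle (ns ! nxt k div 2) i' < lifted_angle (ns ! nxt k div 2) j"
      then have "{cyc_edge k l i', cyc_edge k i j} \<in> ?W"
        using same_pair[of l i k i' j] e(2-4) fl by simp
      then show ?thesis using e(1) f(1) same by (simp add: insert_commute)
    qed
    then show ?thesis using same_type_unique[OF e(2,3) fl(1) ne z1] pe pf same by auto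
  next
    case next_e
    have z1: "z \<in> path_interior (edge_path ns (nxt q) i j)" "z \<in> path_interior (edge_path ns q l i')"
      using z pe pf next_e by simp_all
    have e': "i < ns ! nxt q" "j < ns ! nxt (nxt q)" using e next_e by simp_all
    have "{e, f} \<in> ?W"
      using mixed[OF f(2) e' f(3) z1] e(1) f(1) next_e by simp
    then show ?thesis using mixed_type_unique[OF f(2) e'(1) f(3) z1] pe pf next_e by auto
  next
    case next_f
    have z1: "z \<in> path_interior (edge_path ns (nxt k) l i')" "z \<in> path_interior (edge_path ns k i j)"
      using z pe pf next_f by simp_all
    have f': "l < ns ! nxt k" "i' < ns ! nxt (nxt k)" using f next_f by simp_all
    have "{f, e} \<in> ?W"
      using mixed[OF e(2) f' e(3) z1] e(1) f(1) next_f by simp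
    then have "{e, f} \<in> ?W" by (simp only: insert_commute)
    then show ?thesis using mixed_type_unique[OF e(2) f'(1) e(3) z1] pe pf next_f by auto
  qed
  then show "{e, f} \<in> ?W"
    and "z' \<in> path_interior (drawing_path ns e) \<Longrightarrow> z' \<in> path_interior (drawing_path ns f) \<Longrightarrow> z = z'"
    by blast+
qed

lemma drawing_path_drawing:
  assumes ns: "length ns = 3"
  shows "partite_circle_drawing ns (drawing_pos ns) (drawing_path ns)"
proof -
  have edgeE: "\<exists>k i j. e = cyc_edge k i j \<and> k < 3 \<and> i < ns ! k \<and> j < ns ! nxt k \<and> drawing_path ns e = edge_path ns k i j"
    if "e \<in> multipartite_edges ns" for e
    using that drawing_path_cyc_edge unfolding multipartite_edges_3[OF ns] by blast
  have circ: "path_interior (drawing_path ns e) \<inter> range (cell l 0) = {}" if "e \<in> multipartite_edges ns" "l < 3" for e l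
    using edgeE[OF that(1)] edge_path_interior_not_on_circle that(2) by (metis disjoint_iff)
  have pos_range: "drawing_pos ns v \<in> range (cell (fst v) 0)" for v
    by (cases v) (simp add: drawing_pos_def)
  have "drawing (multipartite_verts ns) (multipartite_edges ns) (drawing_pos ns) (drawing_path ns)"
    unfolding drawing_def
  proof (intro conjI ballI impI)
    show "inj_on (drawing_pos ns) (multipartite_verts ns)"
    proof (rule inj_onI)
      fix u v assume uv: "u \<in> multipartite_verts ns" "v \<in> multipartite_verts ns" "drawing_pos ns u = drawing_pos ns v"
      obtain k i l j where k: "u = (k, i)" "v = (l, j)" by (cases u; cases v)
      have kl: "k < 3" "l < 3" using uv k ns by (auto simp: multipartite_verts_def)
      have eq: "cell k 0 (vertex_angle (ns ! k div 2) i) = cell l 0 (vertex_angle (ns ! l div 2) j)"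
        using uv(3) k by (simp add: drawing_pos_def)
      have "k = l" using cell_0_neq[OF eq _ _ kl] by simp
      then have eq': "cell k 0 (vertex_angle (ns ! k div 2) i) = cell k 0 (vertex_angle (ns ! k div 2) j)"
        using eq by simp
      have "\<bar>vertex_angle (ns ! k div 2) i - vertex_angle (ns ! k div 2) j\<bar> < 6"
        using vertex_angle_range[of "ns ! k div 2" i] vertex_angle_range[of "ns ! k div 2" j] by linarith
      then have "vertex_angle (ns ! k div 2) i = vertex_angle (ns ! k div 2) j"
        using cell_inj_lt(2)[OF eq'] by simp
      then have "i = j"
        using vertex_angle_less_iff[of "ns ! k div 2" i j] vertex_angle_less_iff[of "ns ! k div 2" j i] by simp
      then show "u = v" using k \<open>k = l\<close> by simp
    qed
    fix e assume e: "e \<in> multipartite_edges ns"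
    then obtain k i j where k: "e = cyc_edge k i j" "k < 3" "i < ns ! k" "j < ns ! nxt k" "drawing_path ns e = edge_path ns k i j"
      using edgeE by blast
    show "arc (drawing_path ns e)" using arc_edge_path[OF k(2,3)] k(5) by simp
    show "{pathstart (drawing_path ns e), pathfinish (drawing_path ns e)} = drawing_pos ns ` e"
    proof -
      have "drawing_pos ns ` e = {cell k 0 (vertex_angle (ns ! k div 2) i), cell (nxt k) 0 (vertex_angle (ns ! nxt k div 2) j)}"
        unfolding k(1) cyc_edge_def by (simp add: drawing_pos_def)
      then show ?thesis by (simp only: k(5) edge_path_ends)
    qed
    show "path_interior (drawing_path ns e) \<inter> drawing_pos ns ` multipartite_verts ns = {}"
    proof -
      have "drawing_pos ns v \<notin> path_interior (drawing_path ns e)" if "v \<in> multipartite_verts ns" for v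
      proof -
        have "fst v < 3" using that ns by (auto simp: multipartite_verts_def)
        then show ?thesis using circ[OF e] pos_range[of v] by blast
      qed
      then show ?thesis by blast
    qed
    fix f assume f: "f \<in> multipartite_edges ns" "e \<noteq> f"
    let ?I = "path_interior (drawing_path ns e) \<inter> path_interior (drawing_path ns f)"
    have fin: "finite ?I"
    proof (cases "?I = {}")
      case False
      then obtain z where z: "z \<in> path_interior (drawing_path ns e)" "z \<in> path_interior (drawing_path ns f)" by blast
      have "?I \<subseteq> {z}" using crossing_pair(2)[OF ns e f z] by blast
      then show ?thesis by (rule finite_subset) simp
    qed simp
    have "path_image (drawing_path ns e) \<inter> path_image (drawing_path ns f) \<subseteq> ?I \<union>
        {pathstart (drawing_path ns e), pathfinish (drawing_path ns e), pathstart (drawing_path ns f), pathfinish (drawing_path ns f)}"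
      unfolding path_interior_def by blast
    then show "finite (path_image (drawing_path ns e) \<inter> path_image (drawing_path ns f))"
      by (rule finite_subset) (use fin in simp)
  qed
  moreover have "\<exists>(ctr :: nat \<Rightarrow> complex) (rad :: nat \<Rightarrow> real).
        (\<forall>i<length ns. rad i > 0) \<and>
        (\<forall>i<length ns. \<forall>j<length ns. i \<noteq> j \<longrightarrow>
           sphere (ctr i) (rad i) \<inter> sphere (ctr j) (rad j) = {}) \<and>
        (\<forall>i<length ns. \<forall>j<ns ! i. drawing_pos ns (i, j) \<in> sphere (ctr i) (rad i)) \<and>
        (\<forall>e\<in>multipartite_edges ns. \<forall>i<length ns.
           path_interior (drawing_path ns e) \<inter> sphere (ctr i) (rad i) = {})"
  proof (intro exI conjI allI impI ballI)
    fix i assume i: "i < length ns"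
    show "(1/2 :: real) > 0" by simp
    show "sphere (cis (2 * pi * i / 3) * cell0_center) (1/2) \<inter> sphere (cis (2 * pi * j / 3) * cell0_center) (1/2) = {}"
      if "j < length ns" "i \<noteq> j" for j
      unfolding sphere_eq_cell using cell_0_neq[of i 0 _ j] i that ns by auto
    show "drawing_pos ns (i, j) \<in> sphere (cis (2 * pi * i / 3) * cell0_center) (1/2)" for j
      unfolding sphere_eq_cell using pos_range[of "(i, j)"] by simp
    show "path_interior (drawing_path ns e) \<inter> sphere (cis (2 * pi * i / 3) * cell0_center) (1/2) = {}"
      if "e \<in> multipartite_edges ns" for e
      unfolding sphere_eq_cell using circ[OF that] i ns by simp
  qed
  ultimately show ?thesis unfolding partite_circle_drawing_def by blast
qed

lemma card_less_pairs:
  fixes g :: "'a \<Rightarrow> 'b::linorder"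
  assumes "finite S" "inj_on g S"
  shows "finite {(x, y). x \<in> S \<and> y \<in> S \<and> g x < g y}"
    and "card {(x, y). x \<in> S \<and> y \<in> S \<and> g x < g y} = card S choose 2"
proof -
  let ?P = "{(x, y). x \<in> S \<and> y \<in> S \<and> g x < g y}"
  have "bij_betw (\<lambda>(x, y). {x, y}) ?P {e. e \<subseteq> S \<and> card e = 2}"
  proof (rule bij_betw_imageI)
    show "inj_on (\<lambda>(x, y). {x, y}) ?P"
      by (auto simp: inj_on_def doubleton_eq_iff)
    show "(\<lambda>(x, y). {x, y}) ` ?P = {e. e \<subseteq> S \<and> card e = 2}"
    proof
      show "(\<lambda>(x, y). {x, y}) ` ?P \<subseteq> {e. e \<subseteq> S \<and> card e = 2}"
        by (auto simp: card_insert_if)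
      show "{e. e \<subseteq> S \<and> card e = 2} \<subseteq> (\<lambda>(x, y). {x, y}) ` ?P"
      proof
        fix e assume "e \<in> {e. e \<subseteq> S \<and> card e = 2}"
        then obtain x y where xy: "e = {x, y}" "x \<noteq> y" "x \<in> S" "y \<in> S"
          by (auto simp: card_2_iff)
        then have "g x \<noteq> g y" using assms(2) by (auto dest: inj_onD)
        then consider "g x < g y" | "g y < g x" by fastforce
        then show "e \<in> (\<lambda>(x, y). {x, y}) ` ?P"
        proof cases
          case 1
          then show ?thesis using xy by (intro image_eqI[of _ _ "(x, y)"]) auto
        next
          case 2
          then show ?thesis using xy by (intro image_eqI[of _ _ "(y, x)"]) auto
        qed
      qed
    qed
  qed
  from bij_betw_same_card[OF this] show "card ?P = card S choose 2"
    by (simp only: n_subsets[OF assms(1)])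
  show "finite ?P" by (rule finite_subset[of _ "S \<times> S"]) (use assms(1) in auto)
qed

lemma card_same_type_pairs:
  "finite (same_type_pairs ns k)"
  "card (same_type_pairs ns k) \<le> (ns ! k choose 2) * (ns ! nxt k choose 2)"
proof -
  let ?A = "{(i, i'). i < ns ! k \<and> i' < ns ! k \<and> i < i'}"
  let ?B = "{(j, j'). j < ns ! nxt k \<and> j' < ns ! nxt k \<and>
         lifted_angle (ns ! nxt k div 2) j < lifted_angle (ns ! nxt k div 2) j'}"
  have A: "finite ?A" "card ?A = ns ! k choose 2"
    using card_less_pairs[of "{..<ns ! k}" id] by simp_all
  have "inj_on (lifted_angle (ns ! nxt k div 2)) {..<ns ! nxt k}"
    by (auto simp: inj_on_def lifted_angle_inj)
  then have B: "finite ?B" "card ?B = ns ! nxt k choose 2"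
    using card_less_pairs[of "{..<ns ! nxt k}" "lifted_angle (ns ! nxt k div 2)"] by simp_all
  show "finite (same_type_pairs ns k)"
    unfolding same_type_pairs_def using A B by (intro finite_imageI finite_cartesian_product)
  have "card (same_type_pairs ns k) \<le> card (?A \<times> ?B)"
    unfolding same_type_pairs_def using A B by (intro card_image_le finite_cartesian_product)
  then show "card (same_type_pairs ns k) \<le> (ns ! k choose 2) * (ns ! nxt k choose 2)"
    unfolding card_cartesian_product A B .
qed

text \<open>Pairs inside the inner half, of size \<open>a - a div 2\<close>, and inside the outer
  half, of size \<open>a div 2\<close>, add up to the number from Mantel's theorem.\<close>

lemma choose_2_halves: "(a - a div 2 choose 2) + (a div 2 choose 2) = ((a - 1) div 2) * (a div 2)"
proof -
  have Suc_2: "Suc k choose 2 = k + (k choose 2)" for k :: nat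
    by (simp add: numeral_2_eq_2)
  have 1: "(Suc k choose 2) + (k choose 2) = k * k" for k :: nat
  proof (induction k)
    case (Suc k)
    then show ?case using Suc_2[of k] Suc_2[of "Suc k"] by simp
  qed (simp add: Suc_2)
  have 2: "(k choose 2) + (k choose 2) = (k - 1) * k" for k :: nat
    using 1[of "k - 1"] Suc_2[of "k - 1"] by (cases k) simp_all
  show ?thesis
  proof (cases "even a")
    case True
    then obtain k where "a = 2 * k" by (rule evenE)
    then have "a div 2 = k" "a - a div 2 = k" "(a - 1) div 2 = k - 1" by simp_all
    then show ?thesis using 2[of k] by (simp only:)
  next
    case False
    then obtain k where "a = 2 * k + 1" by (rule oddE)
    then have "a div 2 = k" "a - a div 2 = Suc k" "(a - 1) div 2 = k" by simp_all
    then show ?thesis using 1[of k] by (simp only:)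
  qed
qed

lemma card_mixed_type_pairs:
  "finite (mixed_type_pairs ns q)"
  "card (mixed_type_pairs ns q) \<le> ns ! nxt (nxt q) * ns ! q * (((ns ! nxt q - 1) div 2) * (ns ! nxt q div 2))"
proof -
  let ?a = "ns ! nxt q" and ?h = "ns ! nxt q div 2"
  let ?A = "{(i, i'). ?h \<le> i' \<and> i' < i \<and> i < ?a}" and ?B = "{(i, i'). i < i' \<and> i' < ?h}"
  have "?A = (\<lambda>(x, y). (y, x)) ` {(x, y). x \<in> {?h..<?a} \<and> y \<in> {?h..<?a} \<and> id x < id y}"
    by auto
  then have A: "finite ?A" "card ?A \<le> ?a - ?h choose 2"
    using card_less_pairs[of "{?h..<?a}" id] card_image_le[OF card_less_pairs(1)[of "{?h..<?a}" id], of "\<lambda>(x, y). (y, x)"]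
    by simp_all
  have "?B = {(x, y). x \<in> {..<?h} \<and> y \<in> {..<?h} \<and> id x < id y}" by auto
  then have B: "finite ?B" "card ?B = ?h choose 2"
    using card_less_pairs[of "{..<?h}" id] by simp_all
  let ?C = "({..<ns ! nxt (nxt q)} \<times> {..<ns ! q}) \<times> (?A \<union> ?B)"
  have fin: "finite ?C" using A B by simp
  then show "finite (mixed_type_pairs ns q)" unfolding mixed_type_pairs_def by (rule finite_imageI)
  have "card (?A \<union> ?B) \<le> ((?a - 1) div 2) * (?a div 2)"
    using card_Un_le[of ?A ?B] A B choose_2_halves[of ?a] by linarith
  have "card (mixed_type_pairs ns q) \<le> card ?C"
    unfolding mixed_type_pairs_def using fin by (rule card_image_le)
  also have "\<dots> = ns ! nxt (nxt q) * ns ! q * card (?A \<union> ?B)"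
    by (simp add: card_cartesian_product)
  also have "\<dots> \<le> ns ! nxt (nxt q) * ns ! q * (((?a - 1) div 2) * (?a div 2))"
    using \<open>card (?A \<union> ?B) \<le> _\<close> by (rule mult_left_mono) simp
  finally show "card (mixed_type_pairs ns q) \<le> ns ! nxt (nxt q) * ns ! q * (((?a - 1) div 2) * (?a div 2))" .
qed

text \<open>Two edges cross at most once, so a crossing is determined by its edge pair and counting
  the admissible pairs suffices.\<close>

lemma crossings_drawing_path_le:
  assumes ns: "length ns = 3"
  shows "crossings (multipartite_edges ns) (drawing_path ns) \<le>
    (\<Sum>k<3. (ns ! k choose 2) * (ns ! nxt k choose 2)) +
    (\<Sum>q<3. ns ! nxt (nxt q) * ns ! q * (((ns ! nxt q - 1) div 2) * (ns ! nxt q div 2)))"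
proof -
  let ?X = "cross_between (multipartite_edges ns) (multipartite_edges ns) (drawing_path ns)"
  let ?W1 = "\<Union>k<3. same_type_pairs ns k" and ?W2 = "\<Union>q<3. mixed_type_pairs ns q"
  have inj: "inj_on fst ?X"
  proof (rule inj_onI)
    fix p p' assume p: "p \<in> ?X" "p' \<in> ?X" "fst p = fst p'"
    from p(1) obtain e f z where 1: "p = ({e, f}, z)" "e \<in> multipartite_edges ns" "f \<in> multipartite_edges ns" "e \<noteq> f"
      "z \<in> path_interior (drawing_path ns e)" "z \<in> path_interior (drawing_path ns f)"
      by (rule cross_betweenE)
    from p(2) obtain e' f' z' where 2: "p' = ({e', f'}, z')"
      "z' \<in> path_interior (drawing_path ns e')" "z' \<in> path_interior (drawing_path ns f')"
      by (rule cross_betweenE)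
    have "{e, f} = {e', f'}" using p(3) 1(1) 2(1) by simp
    then have "z' \<in> path_interior (drawing_path ns e)" "z' \<in> path_interior (drawing_path ns f)"
      using 2 unfolding doubleton_eq_iff by auto
    then have "z = z'" by (rule crossing_pair(2)[OF ns 1(2-6)])
    then show "p = p'" using p(3) 1(1) 2(1) by simp
  qed
  have sub: "fst ` ?X \<subseteq> ?W1 \<union> ?W2"
  proof
    fix y assume "y \<in> fst ` ?X"
    then obtain p where p: "p \<in> ?X" "y = fst p" by (rule imageE)
    from p(1) obtain e f z where 1: "p = ({e, f}, z)" "e \<in> multipartite_edges ns" "f \<in> multipartite_edges ns" "e \<noteq> f"
      "z \<in> path_interior (drawing_path ns e)" "z \<in> path_interior (drawing_path ns f)"
      by (rule cross_betweenE)
    show "y \<in> ?W1 \<union> ?W2" using crossing_pair(1)[OF ns 1(2-6)] p(2) 1(1) by simp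
  qed
  have fin: "finite (?W1 \<union> ?W2)"
    using card_same_type_pairs(1) card_mixed_type_pairs(1) by blast
  have "crossings (multipartite_edges ns) (drawing_path ns) \<le> card (?W1 \<union> ?W2)"
    unfolding crossings_eq using inj sub fin by (rule card_inj_on_le)
  also have "\<dots> \<le> card ?W1 + card ?W2" by (rule card_Un_le)
  also have "card ?W1 \<le> (\<Sum>k<3. card (same_type_pairs ns k))" by (rule card_UN_le) simp
  also have "\<dots> \<le> (\<Sum>k<3. (ns ! k choose 2) * (ns ! nxt k choose 2))"
    by (rule sum_mono) (rule card_same_type_pairs(2))
  also have "card ?W2 \<le> (\<Sum>q<3. card (mixed_type_pairs ns q))" by (rule card_UN_le) simp
  also have "\<dots> \<le> (\<Sum>q<3. ns ! nxt (nxt q) * ns ! q * (((ns ! nxt q - 1) div 2) * (ns ! nxt q div 2)))"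
    by (rule sum_mono) (rule card_mixed_type_pairs(2))
  finally show ?thesis by (simp only: add_mono)
qed

lemma tripartite_circle_cr_le:
  "partite_circle_cr [m, n, p]
     \<le> (\<Sum>(a, b, c) \<leftarrow> [(m, n, p), (n, p, m), (p, m, n)].
          enat ((a choose 2) * (b choose 2) + a * b * ((c - 1) div 2) * (c div 2)))"
proof -
  let ?ns = "[m, n, p]"
  have sum3: "(\<Sum>k<3. f k) = f 0 + f 1 + f 2" for f :: "nat \<Rightarrow> nat"
    by (simp add: eval_nat_numeral)
  have nths: "?ns ! 0 = m" "?ns ! 1 = n" "?ns ! 2 = p" by simp_all
  have "partite_circle_cr ?ns \<le> enat (crossings (multipartite_edges ?ns) (drawing_path ?ns))"
    by (rule partite_circle_cr_le[OF drawing_path_drawing]) simp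
  also have "\<dots> \<le> enat ((\<Sum>k<3. (?ns ! k choose 2) * (?ns ! nxt k choose 2)) +
    (\<Sum>q<3. ?ns ! nxt (nxt q) * ?ns ! q * (((?ns ! nxt q - 1) div 2) * (?ns ! nxt q div 2))))"
    using crossings_drawing_path_le[of ?ns] by simp
  also have "(\<Sum>k<3. (?ns ! k choose 2) * (?ns ! nxt k choose 2)) =
      (m choose 2) * (n choose 2) + (n choose 2) * (p choose 2) + (p choose 2) * (m choose 2)"
    unfolding sum3 nxt(4-6) nths ..
  also have "(\<Sum>q<3. ?ns ! nxt (nxt q) * ?ns ! q * (((?ns ! nxt q - 1) div 2) * (?ns ! nxt q div 2))) =
      p * m * (((n - 1) div 2) * (n div 2)) + m * n * (((p - 1) div 2) * (p div 2)) + n * p * (((m - 1) div 2) * (m div 2))"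
    unfolding sum3 nxt(4-6) nths ..
  finally have "partite_circle_cr ?ns \<le>
    enat (((m choose 2) * (n choose 2) + m * n * ((p - 1) div 2) * (p div 2)) +
      (((n choose 2) * (p choose 2) + n * p * ((m - 1) div 2) * (m div 2)) +
       ((p choose 2) * (m choose 2) + p * m * ((n - 1) div 2) * (n div 2))))"
    by (simp only: mult.assoc add.assoc add.commute add.left_commute)
  then show ?thesis
    by (simp only: list.map sum_list.Nil sum_list.Cons prod.case plus_enat_simps add_0_right)
qed

theorem theorem1:
  fixes m n p :: nat
  assumes "m > 0" and "n > 0" and "p > 0"
  shows "(\<Sum>(a, b, c) \<leftarrow> [(m, n, p), (n, p, m), (p, m, n)].
             partite_circle_cr [a, b] + enat (a * b * ((c - 1) div 2) * (c div 2)))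
           \<le> partite_circle_cr [m, n, p]
       \<and> partite_circle_cr [m, n, p]
           \<le> (\<Sum>(a, b, c) \<leftarrow> [(m, n, p), (n, p, m), (p, m, n)].
                enat ((a choose 2) * (b choose 2) + a * b * ((c - 1) div 2) * (c div 2)))"
proof
  show "(\<Sum>(a, b, c) \<leftarrow> [(m, n, p), (n, p, m), (p, m, n)].
             partite_circle_cr [a, b] + enat (a * b * ((c - 1) div 2) * (c div 2)))
           \<le> partite_circle_cr [m, n, p]"
    unfolding partite_circle_cr_def[of "[m, n, p]"]
    by (rule Inf_greatest) (use tripartite_crossings_ge in blast)
qed (rule tripartite_circle_cr_le)


end
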